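(* Let $1\leq p,q<\infty$ be real numbers such that at least one of $p$, $q$ is strictly bigger than $1$. Then the complex Banach space $(\mathbb{C}^2,\|\cdot\|_{B_{p,q}})$ does not have Property P, and hence it does not have a unique operator space structure.
   Context: $B_{p,q}:=\{(z_1,z_2)\in\mathbb{C}^2:|z_1|^p+|z_2|^q<1\}$, and $\|\cdot\|_{B_{p,q}}$ is the norm on $\mathbb{C}^2$ whose open unit ball is $B_{p,q}$ (its Minkowski functional). Property P: let $X=(\mathbb{C}^n,\|\cdot\|_X)$ be a finite dimensional Banach space, with dual $X^*=(\mathbb{C}^n,\|\cdot\|_{X^*})$ under the pairing $\sum_i\lambda_i\mu_i$, so that $\|\mu\|_{X^*}=\sup\{|\sum_i\lambda_i\mu_i|:\|\lambda\|_X\le 1\}$. An $n\times n$ matrix $A$ is regarded, via the usual bases, as a linear map $X\to X^*$ or $X^*\to X$, with operator norm $\|A\|_{X\to X^*}$ or $\|A\|_{X^*\to X}$ respectively. Define $$\gamma(X):=\sup\{\langle A,B\rangle: A\geq 0,\ B\geq 0,\ \|A\|_{X\to X^*}\leq 1,\ \|B\|_{X^*\to X}\leq 1\},$$ where $A,B$ range over positive semidefinite $n\times n$ matrices and $\langle A,B\rangle=\mathrm{Tr}(AB^* )$ is the Hilbert–Schmidt inner product. $X$ has Property P if $\gamma(X)=1$. Unique operator space structure: an operator space structure on a Banach space $X$ is a sequence of norms $\|\cdot\|_n$ on $M_n(X)$ ($n\times n$ matrices over $X$), $n\geq 1$, with $\|\cdot\|_1$ equal to the given norm of $X$, such that $\|A\oplus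 B\|_{m+n}=\max\{\|A\|_n,\|B\|_m\}$ for all $A\in M_n(X)$, $B\in M_m(X)$, and $\|ACB\|_n\leq\|A\|_{\ell_2^m\to\ell_2^n}\|C\|_m\|B\|_{\ell_2^n\to\ell_2^m}$ for all scalar matrices $A\in M_{n,m}$, $B\in M_{m,n}$ and all $C\in M_m(X)$. $X$ has a unique operator space structure if it admits only one such sequence of norms; equivalently, the minimal and maximal operator space structures $MIN$ and $MAX$ on $X$ coincide completely isometrically. *)

theory Defs
  imports "HOL-Analysis.Analysis" "Jordan_Normal_Form.Matrix"
begin

text \<open>
  A normed space \<open>X = (\<complex>\<^sup>n, N)\<close> is represented by a function \<open>N\<close> on \<^typ>\<open>complex ^ 'n\<close>, because
  the type itself already carries the Euclidean norm. Square matrices acting on \<open>\<complex>\<^sup>n\<close> have type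
  \<^typ>\<open>complex ^ 'n ^ 'n\<close>; matrices whose size varies (the matrix levels of an operator space
  structure) are Jordan-Normal-Form matrices, whose carrier sets are indexed by natural numbers.
\<close>

subsection \<open>The space with unit ball \<open>B\<^sub>p\<^sub>,\<^sub>q\<close>\<close>

definition minkowski_functional :: "'v::real_vector set \<Rightarrow> 'v \<Rightarrow> real" where
  "minkowski_functional S x = Inf {t. 0 < t \<and> x /\<^sub>R t \<in> S}"

definition Bpq :: "real \<Rightarrow> real \<Rightarrow> (complex ^ 2) set" where
  "Bpq p q = {z. cmod (z $ 1) powr p + cmod (z $ 2) powr q < 1}"

definition norm_Bpq :: "real \<Rightarrow> real \<Rightarrow> complex ^ 2 \<Rightarrow> real" where
  "norm_Bpq p q = minkowski_functional (Bpq p q)"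


subsection \<open>Property P\<close>

text \<open>The pairing is bilinear: there is no conjugation.\<close>

definition dual_norm :: "(complex ^ 'n \<Rightarrow> real) \<Rightarrow> complex ^ 'n \<Rightarrow> real" where
  "dual_norm N \<mu> = Sup {cmod (\<Sum>i\<in>UNIV. l $ i * \<mu> $ i) | l. N l \<le> 1}"

definition op_norm ::
    "(complex ^ 'n \<Rightarrow> real) \<Rightarrow> (complex ^ 'n \<Rightarrow> real) \<Rightarrow> complex ^ 'n ^ 'n \<Rightarrow> real" where
  "op_norm N M A = Sup {M (A *v x) | x. N x \<le> 1}"

definition conj_transpose :: "complex ^ 'n ^ 'm \<Rightarrow> complex ^ 'm ^ 'n" where
  "conj_transpose A = (\<chi> i j. cnj (A $ j $ i))"

definition pos_semidef :: "complex ^ 'n ^ 'n \<Rightarrow> bool" where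
  "pos_semidef A \<longleftrightarrow>
     conj_transpose A = A \<and> (\<forall>x. 0 \<le> Re (\<Sum>i\<in>UNIV. cnj (x $ i) * (A *v x) $ i))"

definition hs_inner :: "complex ^ 'n ^ 'n \<Rightarrow> complex ^ 'n ^ 'n \<Rightarrow> complex" where
  "hs_inner A B = trace (A ** conj_transpose B)"

text \<open>
  For positive semidefinite \<open>A\<close> and \<open>B\<close> the number \<open>\<langle>A, B\<rangle>\<close> is real and nonnegative, so taking its
  real part loses nothing. If \<open>N\<close> is a norm, all suprema above and below are taken over nonempty
  bounded sets of reals.
\<close>

definition gamma_const :: "(complex ^ 'n \<Rightarrow> real) \<Rightarrow> real" where
  "gamma_const N = Sup {Re (hs_inner A B) | A B.
     pos_semidef A \<and> pos_semidef B \<and>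
     op_norm N (dual_norm N) A \<le> 1 \<and> op_norm (dual_norm N) N B \<le> 1}"

definition property_P :: "(complex ^ 'n \<Rightarrow> real) \<Rightarrow> bool" where
  "property_P N \<longleftrightarrow> gamma_const N = 1"


subsection \<open>Operator space structures\<close>

definition l2_norm :: "complex Matrix.vec \<Rightarrow> real" where
  "l2_norm v = L2_set (\<lambda>i. cmod (vec_index v i)) {..<dim_vec v}"

definition l2_op_norm :: "complex Matrix.mat \<Rightarrow> real" where
  "l2_op_norm A = Sup {l2_norm (A *\<^sub>v v) | v. v \<in> carrier_vec (dim_col A) \<and> l2_norm v \<le> 1}"

text \<open>The product \<open>A C B\<close> of scalar matrices \<open>A\<close>, \<open>B\<close> with a matrix \<open>C\<close> over \<open>\<complex>\<^sup>n\<close>.\<close>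

definition bimod_mult ::
    "complex Matrix.mat \<Rightarrow> (complex ^ 'n) Matrix.mat \<Rightarrow> complex Matrix.mat \<Rightarrow> (complex ^ 'n) Matrix.mat"
  where
  "bimod_mult A C B = Matrix.mat (dim_row A) (dim_col B)
     (\<lambda>(i, j). \<Sum>k<dim_row C. \<Sum>l<dim_col C. (A $$ (i, k) * B $$ (l, j)) *s (C $$ (k, l)))"

definition mat_dsum :: "'a::zero Matrix.mat \<Rightarrow> 'a Matrix.mat \<Rightarrow> 'a Matrix.mat" where
  "mat_dsum A B =
     four_block_mat A (0\<^sub>m (dim_row A) (dim_col B)) (0\<^sub>m (dim_row B) (dim_col A)) B"

definition is_norm_on_matrices :: "nat \<Rightarrow> ((complex ^ 'n) Matrix.mat \<Rightarrow> real) \<Rightarrow> bool" where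
  "is_norm_on_matrices n \<nu> \<longleftrightarrow>
     (\<forall>C\<in>carrier_mat n n. 0 \<le> \<nu> C \<and> (\<nu> C = 0 \<longleftrightarrow> C = 0\<^sub>m n n)) \<and>
     (\<forall>c. \<forall>C\<in>carrier_mat n n. \<nu> (map_mat ((*s) c) C) = cmod c * \<nu> C) \<and>
     (\<forall>C\<in>carrier_mat n n. \<forall>D\<in>carrier_mat n n. \<nu> (C + D) \<le> \<nu> C + \<nu> D)"

text \<open>Only the values of \<open>\<nu> n\<close> on \<open>carrier_mat n n\<close>, for \<open>n \<ge> 1\<close>, are relevant.\<close>

definition operator_space_structure ::
    "(complex ^ 'n \<Rightarrow> real) \<Rightarrow> (nat \<Rightarrow> (complex ^ 'n) Matrix.mat \<Rightarrow> real) \<Rightarrow> bool" where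
  "operator_space_structure N \<nu> \<longleftrightarrow>
     (\<forall>n\<ge>1. is_norm_on_matrices n (\<nu> n)) \<and>
     (\<forall>x. \<nu> 1 (Matrix.mat 1 1 (\<lambda>_. x)) = N x) \<and>
     (\<forall>n\<ge>1. \<forall>m\<ge>1. \<forall>A\<in>carrier_mat n n. \<forall>B\<in>carrier_mat m m.
        \<nu> (m + n) (mat_dsum A B) = max (\<nu> n A) (\<nu> m B)) \<and>
     (\<forall>n\<ge>1. \<forall>m\<ge>1. \<forall>A\<in>carrier_mat n m. \<forall>B\<in>carrier_mat m n. \<forall>C\<in>carrier_mat m m.
        \<nu> n (bimod_mult A C B) \<le> l2_op_norm A * \<nu> m C * l2_op_norm B)"

text \<open>
  Every norm admits at least one operator space structure (for instance \<open>MIN\<close>), so uniqueness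
  amounts to any two structures agreeing on all \<open>M\<^sub>n(X)\<close>.
\<close>

definition unique_operator_space_structure :: "(complex ^ 'n \<Rightarrow> real) \<Rightarrow> bool" where
  "unique_operator_space_structure N \<longleftrightarrow>
     (\<forall>\<nu> \<nu>'. operator_space_structure N \<nu> \<and> operator_space_structure N \<nu>' \<longrightarrow>
        (\<forall>n\<ge>1. \<forall>C\<in>carrier_mat n n. \<nu> n C = \<nu>' n C))"

end

theory Submission
  imports Defs "HOL-Real_Asymp.Real_Asymp"
begin

text \<open>
  Let \<open>x\<^sub>0 = (r\<^sub>0, s\<^sub>0)\<close> be a point with positive coordinates on the curve \<open>r\<^sup>p + s\<^sup>q = 1\<close>, let \<open>v\<close> be the
  functional supporting the unit ball there, normalised by \<open>v \<cdot> x\<^sub>0 = 1\<close>, and put \<open>u = (s\<^sub>0, -r\<^sub>0)\<close>. Near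
  \<open>x\<^sub>0\<close> the curve is smooth, and it has positive curvature because \<open>p > 1\<close> or \<open>q > 1\<close>. Hence on the
  positive quadrant the squared norm is squeezed between two quadratic forms
  \<open>(v \<cdot> x)\<^sup>2 + t (u \<cdot> x)\<^sup>2 \<le> N(x)\<^sup>2 \<le> (v \<cdot> x)\<^sup>2 + T (u \<cdot> x)\<^sup>2\<close> with \<open>0 < t\<close>. Dualising the second inequality
  gives \<open>(x\<^sub>0 \<cdot> \<mu>)\<^sup>2 + (w \<cdot> \<mu>)\<^sup>2 / T \<le> N\<^sup>*(\<mu>)\<^sup>2\<close> where \<open>(x\<^sub>0, w)\<close> is the basis dual to \<open>(v, u)\<close>. As long as
  the off-diagonal entries of the forms are nonnegative, these bounds pass to complex vectors.
  The Gram matrices \<open>A = v v\<^sup>T + t u u\<^sup>T\<close> and \<open>B = x\<^sub>0 x\<^sub>0\<^sup>T + w w\<^sup>T / T\<close> then have operator norm at most 1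
  and \<open>\<langle>A, B\<rangle> = 1 + t / T > 1\<close>, so Property P fails.

  The same data show that \<open>x \<mapsto> (v \<cdot> x, \<surd>t u \<cdot> x)\<close> is a contraction into the column space \<open>M\<^sub>2\<^sub>,\<^sub>1\<close> which is not
  completely contractive on \<open>MIN\<close>: the column with entries \<open>x\<^sub>0\<close>, \<open>w / \<surd>T\<close> has \<open>MIN\<close>-norm at most 1,
  and its image has norm \<open>\<surd>(1 + t / T)\<close>. Enlarging the norms of \<open>MIN\<close> by this map gives a
  second operator space structure.
\<close>

section \<open>Comparing the curve with two ellipses\<close>

text \<open>Strict convexity at 1: by the mean value theorem the secant slope is
  \<open>p * z powr (p - 1)\<close> for some \<open>z\<close> strictly between, and this lies
  strictly on one side of \<open>p\<close>. The endpoint \<open>y = 0\<close> is separate because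
  the derivative rule is stated for positive arguments.\<close>

lemma bernoulli_powr_strict:
  fixes p y :: real
  assumes "p > 1" "y \<ge> 0" "y \<noteq> 1"
  shows "1 + p * (y - 1) < y powr p"
proof -
  have d: "((\<lambda>y. y powr p) has_real_derivative p * z powr (p - 1)) (at z)" if "z > 0" for z :: real
    using that by (auto intro!: derivative_eq_intros)
  consider "y = 0" | "0 < y" "y < 1" | "y > 1" using assms by linarith
  then show ?thesis
  proof cases
    case 1
    then show ?thesis using assms by simp
  next
    case 2
    obtain z where z: "y < z" "z < 1" "1 powr p - y powr p = (1 - y) * (p * z powr (p - 1))"
      using MVT2[of y 1 "\<lambda>y. y powr p" "\<lambda>z. p * z powr (p - 1)"] d 2 by auto
    have "z powr (p - 1) < 1"
      using z 2 assms powr_less_mono2[of "p - 1" z 1] by simp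
    then have "(1 - y) * (p * z powr (p - 1)) < (1 - y) * p"
      using 2 assms by simp
    then show ?thesis using z by (simp add: algebra_simps)
  next
    case 3
    obtain z where z: "1 < z" "z < y" "y powr p - 1 powr p = (y - 1) * (p * z powr (p - 1))"
      using MVT2[of 1 y "\<lambda>y. y powr p" "\<lambda>z. p * z powr (p - 1)"] d 3 by auto
    have "1 < z powr (p - 1)"
      using z assms powr_less_mono2[of "p - 1" 1 z] by simp
    then have "(y - 1) * p < (y - 1) * (p * z powr (p - 1))"
      using 3 assms by simp
    then show ?thesis using z by (simp add: algebra_simps)
  qed
qed

text \<open>The remainder divided by \<open>(y - 1)\<^sup>2\<close> extends continuously to
  \<open>y = 1\<close>, with half the second derivative as value, and is positive by strict
  convexity. Compactness of \<open>{0..M}\<close> turns positivity into uniform constants.\<close>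

lemma bernoulli_powr_quadratic:
  fixes p M :: real
  assumes "p > 1" "M \<ge> 0"
  obtains k K where "k > 0" "K > 0"
    "\<And>y. 0 \<le> y \<Longrightarrow> y \<le> M \<Longrightarrow> k * (y - 1)\<^sup>2 \<le> y powr p - 1 - p * (y - 1)"
    "\<And>y. 0 \<le> y \<Longrightarrow> y \<le> M \<Longrightarrow> y powr p - 1 - p * (y - 1) \<le> K * (y - 1)\<^sup>2"
proof -
  define g where "g = (\<lambda>y. (y powr p - 1 - p * (y - 1)) / (y - 1)\<^sup>2)"
  define h where "h = (\<lambda>y. if y = 1 then p * (p - 1) / 2 else g y)"
  have pos: "h y > 0" if "y \<ge> 0" for y
    using that assms bernoulli_powr_strict[of p y] by (auto simp: h_def g_def)
  have lim: "(g \<longlongrightarrow> p * (p - 1) / 2) (at 1)"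
    unfolding g_def using assms by real_asymp
  have "continuous (at y within {0..M}) h" if y: "y \<in> {0..M}" for y
  proof (cases "y = 1")
    case True
    have "(h \<longlongrightarrow> h 1) (at 1)"
      by (rule Lim_transform_eventually[where f = g]) (simp_all add: h_def eventually_at_filter lim)
    then show ?thesis
      using True by (simp add: continuous_within tendsto_within_subset[OF _ subset_UNIV])
  next
    case False
    \<comment> \<open>The interval contains 0; continuity of the power there rests on
      \<open>p > 0\<close> and nonnegative bases.\<close>
    have "((\<lambda>y. y powr p) \<longlongrightarrow> y powr p) (at y within {0..M})"
      by (rule tendsto_powr2) (use assms y in \<open>auto intro!: tendsto_intros simp: eventually_at_filter\<close>)
    then have "(g \<longlongrightarrow> g y) (at y within {0..M})"
      unfolding g_def using False by (auto intro!: tendsto_intros)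
    moreover have "eventually (\<lambda>z. g z = h z) (at y within {0..M})"
      using eventually_neq_at_within[of 1 y "{0..M}"] by eventually_elim (simp add: h_def)
    ultimately have "(h \<longlongrightarrow> g y) (at y within {0..M})"
      by (rule Lim_transform_eventually)
    then show ?thesis using False by (simp add: continuous_within h_def)
  qed
  then have cont: "continuous_on {0..M} h"
    by (simp add: continuous_on_eq_continuous_within)
  have ne: "{0..M} \<noteq> {}" using assms by simp
  obtain a where a: "a \<in> {0..M}" "\<And>y. y \<in> {0..M} \<Longrightarrow> h a \<le> h y"
    using continuous_attains_inf[OF compact_Icc ne cont] by blast
  obtain b where b: "b \<in> {0..M}" "\<And>y. y \<in> {0..M} \<Longrightarrow> h y \<le> h b"
    using continuous_attains_sup[OF compact_Icc ne cont] by blast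
  have eq: "y powr p - 1 - p * (y - 1) = h y * (y - 1)\<^sup>2" for y
    by (simp add: h_def g_def)
  show ?thesis
  proof
    show "h a > 0" "h b > 0" using a b pos by auto
    show "h a * (y - 1)\<^sup>2 \<le> y powr p - 1 - p * (y - 1)" if "0 \<le> y" "y \<le> M" for y
      unfolding eq using a that by (intro mult_right_mono) auto
    show "y powr p - 1 - p * (y - 1) \<le> h b * (y - 1)\<^sup>2" if "0 \<le> y" "y \<le> M" for y
      unfolding eq using b that by (intro mult_right_mono) auto
  qed
qed

text \<open>Homogeneity moves the point of tangency from \<open>a\<close> to 1, where the Bernoulli
  estimates apply.\<close>

lemma powr_tangent_scaled:
  fixes a b p :: real
  assumes "a > 0" "b \<ge> 0"
  shows "b powr p - a powr p - p * a powr (p - 1) * (b - a) =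
    a powr p * ((b / a) powr p - 1 - p * (b / a - 1))"
proof -
  have "a powr (p - 1) = a powr p / a" using assms by (simp add: powr_diff)
  then show ?thesis using assms by (simp add: powr_divide field_simps)
qed

lemma powr_ge_tangent:
  fixes a b p :: real
  assumes "p \<ge> 1" "a \<ge> 0" "b \<ge> 0"
  shows "p * a powr (p - 1) * (b - a) \<le> b powr p - a powr p"
proof (cases "a = 0 \<or> p = 1 \<or> a = b")
  \<comment> \<open>For \<open>a = 0\<close> the left side is 0 even when \<open>p = 1\<close>,
    because \<open>0 powr 0 = 0\<close>; the claim is then \<open>0 \<le> b powr p\<close>.\<close>
  case True
  then show ?thesis using assms by auto
next
  case False
  then have "1 + p * (b / a - 1) < (b / a) powr p"
    using assms by (intro bernoulli_powr_strict) auto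
  then have "0 \<le> a powr p * ((b / a) powr p - 1 - p * (b / a - 1))"
    using assms by simp
  then show ?thesis using powr_tangent_scaled[of a b p] False assms by simp
qed

lemma powr_tangent_quadratic:
  fixes a p :: real
  assumes "p > 1" "a > 0"
  obtains k K where "k > 0" "K > 0"
    "\<And>b. 0 \<le> b \<Longrightarrow> b \<le> 1 \<Longrightarrow> k * (b - a)\<^sup>2 \<le> b powr p - a powr p - p * a powr (p - 1) * (b - a)"
    "\<And>b. 0 \<le> b \<Longrightarrow> b \<le> 1 \<Longrightarrow> b powr p - a powr p - p * a powr (p - 1) * (b - a) \<le> K * (b - a)\<^sup>2"
proof -
  obtain k K where k: "k > 0" "K > 0"
    and lo: "\<And>y. 0 \<le> y \<Longrightarrow> y \<le> 1 / a \<Longrightarrow> k * (y - 1)\<^sup>2 \<le> y powr p - 1 - p * (y - 1)"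
    and up: "\<And>y. 0 \<le> y \<Longrightarrow> y \<le> 1 / a \<Longrightarrow> y powr p - 1 - p * (y - 1) \<le> K * (y - 1)\<^sup>2"
    using bernoulli_powr_quadratic[of p "1 / a"] assms by auto
  have sq: "(b / a - 1)\<^sup>2 = (b - a)\<^sup>2 / a\<^sup>2" for b
    using assms by (simp add: field_simps power2_eq_square)
  show ?thesis
  proof
    show "a powr p * k / a\<^sup>2 > 0" "a powr p * K / a\<^sup>2 > 0" using k assms by auto
    fix b :: real assume b: "0 \<le> b" "b \<le> 1"
    have y: "0 \<le> b / a" "b / a \<le> 1 / a" using b assms by (auto simp: divide_right_mono)
    note eq = powr_tangent_scaled[OF assms(2) b(1), of p]
    have "a powr p * (k * (b / a - 1)\<^sup>2) \<le> a powr p * ((b / a) powr p - 1 - p * (b / a - 1))"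
      by (intro mult_left_mono lo y) auto
    then show "a powr p * k / a\<^sup>2 * (b - a)\<^sup>2 \<le> b powr p - a powr p - p * a powr (p - 1) * (b - a)"
      unfolding eq sq by simp
    have "a powr p * ((b / a) powr p - 1 - p * (b / a - 1)) \<le> a powr p * (K * (b / a - 1)\<^sup>2)"
      by (intro mult_left_mono up y) auto
    then show "b powr p - a powr p - p * a powr (p - 1) * (b - a) \<le> a powr p * K / a\<^sup>2 * (b - a)\<^sup>2"
      unfolding eq sq by simp
  qed
qed

text \<open>The tangent at \<open>y\<close> bounds the increment, and its slope is at most
  \<open>p\<close> on the unit interval.\<close>

lemma powr_diff_le:
  fixes a b p :: real
  assumes "p \<ge> 1" "0 \<le> a" "a \<le> 1" "0 \<le> b" "b \<le> 1"
  shows "\<bar>b powr p - a powr p\<bar> \<le> p * \<bar>b - a\<bar>"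
proof -
  have *: "y powr p - x powr p \<le> p * \<bar>y - x\<bar>"
    if "0 \<le> x" "x \<le> 1" "0 \<le> y" "y \<le> 1" for x y
  proof -
    have "y powr p - x powr p \<le> p * (y powr (p - 1) * (y - x))"
      using powr_ge_tangent[of p y x] that assms by (simp add: algebra_simps)
    also have "y powr (p - 1) * (y - x) \<le> 1 * \<bar>y - x\<bar>"
      using that assms powr_mono2[of "p - 1" y 1]
      by (intro order_trans[OF mult_left_mono[OF abs_ge_self] mult_right_mono]) auto
    finally show ?thesis using assms by (simp add: mult_left_mono)
  qed
  show ?thesis
    using *[of a b] *[of b a] assms by (intro abs_leI) (simp_all add: abs_minus_commute)
qed

text \<open>Write \<open>x powr p = x * x powr (p - 1)\<close> and use monotonicity of the second
  factor. In the curve argument this bounds the displacement in one coordinate by that in the other,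
  for exponent 1 as well.\<close>

lemma powr_diff_ge:
  fixes a b p :: real
  assumes "p \<ge> 1" "0 < a" "0 \<le> b"
  shows "a powr (p - 1) * \<bar>b - a\<bar> \<le> \<bar>b powr p - a powr p\<bar>"
proof -
  have e: "x powr p = x * x powr (p - 1)" if "x \<ge> 0" for x :: real
    using that powr_mult_base[of x "p - 1"] by simp
  show ?thesis
  proof (cases "a \<le> b")
    case True
    then have "a powr (p - 1) * b \<le> b powr (p - 1) * b"
      using assms by (intro mult_right_mono powr_mono2) auto
    then have "a powr (p - 1) * \<bar>b - a\<bar> \<le> b powr p - a powr p"
      using True assms e[of a] e[of b] by (simp add: algebra_simps)
    then show ?thesis by linarith
  next
    case False
    then have "b powr (p - 1) * b \<le> a powr (p - 1) * b"
      using assms by (intro mult_right_mono powr_mono2) auto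
    then show ?thesis using False assms e[of a] e[of b] by (simp add: algebra_simps)
  qed
qed

lemma le_one_if_powr_le_one:
  fixes x p :: real
  assumes "x \<ge> 0" "p > 0" "x powr p \<le> 1"
  shows "x \<le> 1"
proof (rule ccontr)
  assume "\<not> x \<le> 1"
  then have "1 powr p < x powr p" using assms by (intro powr_less_mono2) auto
  then show False using assms(3) unfolding powr_one_eq_one by linarith
qed

text \<open>For the supporting functional \<open>L\<close>, the gap \<open>1 - L\<close> on the
  curve is, up to the factor \<open>c\<close>, a sum of two tangent remainders and hence of second
  order in the displacement \<open>(a, b)\<close> from the contact point. The curve ties
  \<open>a\<close> and \<open>b\<close> together, which makes the gap comparable with the square of
  \<open>s0 * a - r0 * b\<close>.\<close>

lemma curve_between_ellipses_aux:
  fixes p q :: real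
  assumes p: "p > 1" and q: "q \<ge> 1"
  obtains v1 r0 v2 s0 t T where
    "v1 * r0 + v2 * s0 = 1" "t * (r0 * s0) \<le> v1 * v2" "v1 * v2 \<le> T * (r0 * s0)"
    "r0 > 0" "s0 > 0" "v1 > 0" "v2 > 0" "t > 0" "T > 0"
    "\<And>r s. r \<ge> 0 \<Longrightarrow> s \<ge> 0 \<Longrightarrow> r powr p + s powr q = 1 \<Longrightarrow>
      (v1 * r + v2 * s)\<^sup>2 + t * (s0 * r - r0 * s)\<^sup>2 \<le> 1"
    "\<And>r s. r \<ge> 0 \<Longrightarrow> s \<ge> 0 \<Longrightarrow> r powr p + s powr q = 1 \<Longrightarrow>
      1 \<le> (v1 * r + v2 * s)\<^sup>2 + T * (s0 * r - r0 * s)\<^sup>2"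
proof -
  \<comment> \<open>At this contact point both terms of the curve equation equal 1/2, so both
    coordinates are positive.\<close>
  define r0 s0 :: real where "r0 = (1/2) powr (1/p)" and "s0 = (1/2) powr (1/q)"
  have r0: "0 < r0" "r0 \<le> 1" "r0 powr p = 1/2"
    and s0: "0 < s0" "s0 \<le> 1" "s0 powr q = 1/2"
    using p q by (auto simp: r0_def s0_def powr_powr intro!: powr_le1)
  \<comment> \<open>The gradient paired with \<open>(r0, s0)\<close> gives \<open>c\<close>;
    dividing by it normalises the supporting functional.\<close>
  define c where "c = p * r0 powr p + q * s0 powr q"
  have c: "c \<ge> 1" unfolding c_def r0(3) s0(3) using p q by simp
  define v1 v2 where "v1 = p * r0 powr (p - 1) / c" and "v2 = q * s0 powr (q - 1) / c"
  have v: "v1 > 0" "v2 > 0" using p q r0 s0 c by (auto simp: v1_def v2_def)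
  have e: "x * x powr (a - 1) = x powr a" if "x > 0" for x a :: real
    using that powr_mult_base[of x "a - 1"] by simp
  have vx0: "v1 * r0 + v2 * s0 = 1"
  proof -
    have "v1 * r0 + v2 * s0 = (p * (r0 * r0 powr (p - 1)) + q * (s0 * s0 powr (q - 1))) / c"
      by (simp add: v1_def v2_def add_divide_distrib mult_ac)
    also have "\<dots> = c / c" unfolding c_def using r0(1) s0(1) by (simp only: e)
    also have "\<dots> = 1" using c by simp
    finally show ?thesis .
  qed
  obtain k K1 where k: "k > 0" "K1 > 0"
    and klo: "\<And>r. 0 \<le> r \<Longrightarrow> r \<le> 1 \<Longrightarrow> k * (r - r0)\<^sup>2 \<le> r powr p - r0 powr p - p * r0 powr (p - 1) * (r - r0)"
    and kup: "\<And>r. 0 \<le> r \<Longrightarrow> r \<le> 1 \<Longrightarrow> r powr p - r0 powr p - p * r0 powr (p - 1) * (r - r0) \<le> K1 * (r - r0)\<^sup>2"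
    by (rule powr_tangent_quadratic[OF p r0(1)]) (rule that)
  obtain K2 where K2: "K2 > 0"
    and qup: "\<And>s. 0 \<le> s \<Longrightarrow> s \<le> 1 \<Longrightarrow> s powr q - s0 powr q - q * s0 powr (q - 1) * (s - s0) \<le> K2 * (s - s0)\<^sup>2"
  proof (cases "q = 1")
    \<comment> \<open>The remainder of a linear function vanishes, so any positive constant
      serves.\<close>
    case True
    then show ?thesis using that[of 1] s0 by auto
  next
    case False
    then have "q > 1" using q by simp
    then show ?thesis by (rule powr_tangent_quadratic[OF _ s0(1)]) (rule that)
  qed
  \<comment> \<open>\<open>E\<close> bounds the displacement in \<open>s\<close> by that in
    \<open>r\<close> along the curve. The second arguments of \<open>min\<close> and
    \<open>max\<close> secure the signs of the off-diagonal entries.\<close>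
  define E where "E = p / s0 powr (q - 1)"
  define t where "t = min (k / (2 * c * (1 + E\<^sup>2))) (v1 * v2 / (r0 * s0))"
  define T where "T = max (2 * K1 / (c * s0\<^sup>2) + 2 * K2 / (c * r0\<^sup>2)) (v1 * v2 / (r0 * s0))"
  have E2: "1 + E\<^sup>2 > 0" by (simp add: add_pos_nonneg)
  have t: "t > 0" "t \<le> k / (2 * c * (1 + E\<^sup>2))" "t * (r0 * s0) \<le> v1 * v2"
  proof -
    have "t \<le> v1 * v2 / (r0 * s0)" by (simp add: t_def)
    then show "t * (r0 * s0) \<le> v1 * v2" using r0 s0 by (simp add: pos_le_divide_eq)
    show "t > 0" unfolding t_def min_less_iff_conj using k c E2 v r0 s0
      by (intro conjI divide_pos_pos mult_pos_pos) auto
  qed (simp add: t_def)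
  have T: "T > 0" "T \<ge> 2 * K1 / (c * s0\<^sup>2) + 2 * K2 / (c * r0\<^sup>2)" "v1 * v2 \<le> T * (r0 * s0)"
  proof -
    show "T \<ge> 2 * K1 / (c * s0\<^sup>2) + 2 * K2 / (c * r0\<^sup>2)" by (simp add: T_def)
    have "T \<ge> v1 * v2 / (r0 * s0)" by (simp add: T_def)
    then show "v1 * v2 \<le> T * (r0 * s0)" using r0 s0 by (simp add: pos_divide_le_eq)
    have "v1 * v2 / (r0 * s0) > 0" using v r0 s0 by simp
    then show "T > 0" using \<open>T \<ge> v1 * v2 / (r0 * s0)\<close> by linarith
  qed
  have main: "(v1 * r + v2 * s)\<^sup>2 + t * (s0 * r - r0 * s)\<^sup>2 \<le> 1 \<and>
      1 \<le> (v1 * r + v2 * s)\<^sup>2 + T * (s0 * r - r0 * s)\<^sup>2"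
    if r: "r \<ge> 0" and s: "s \<ge> 0" and rs: "r powr p + s powr q = 1" for r s
  proof -
    have rp: "r powr p \<le> 1" "s powr q \<le> 1" using rs powr_ge_zero[of s q] powr_ge_zero[of r p] by linarith+
    have r1: "r \<le> 1" using rp(1) r p le_one_if_powr_le_one[of r p] by simp
    have s1: "s \<le> 1" using rp(2) s q le_one_if_powr_le_one[of s q] by simp
    define a b where "a = r - r0" and "b = s - s0"
    define L where "L = v1 * r + v2 * s"
    have L0: "L \<ge> 0" using v r s by (simp add: L_def)
    \<comment> \<open>Both points lie on the curve, so the increments of the two powers cancel and
      only the linear parts of the remainders survive.\<close>
    have cL: "c * (1 - L) = (r powr p - r0 powr p - p * r0 powr (p - 1) * a) +
        (s powr q - s0 powr q - q * s0 powr (q - 1) * b)"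
    proof -
      have "c * (1 - L) = c * (v1 * r0 + v2 * s0 - L)" using vx0 by simp
      also have "\<dots> = c * (- (v1 * a) - v2 * b)" by (simp add: L_def a_def b_def algebra_simps)
      also have "\<dots> = - (p * r0 powr (p - 1) * a) - q * s0 powr (q - 1) * b"
        using c by (simp add: v1_def v2_def field_simps)
      finally show ?thesis using rs r0 s0 by simp
    qed
    \<comment> \<open>Curvature is taken from the first coordinate, where \<open>p > 1\<close>; the
      second remainder vanishes when \<open>q = 1\<close> and enters only as nonnegative.\<close>
    have lo: "k * a\<^sup>2 \<le> c * (1 - L)"
      using klo[OF r r1] powr_ge_tangent[of q s0 s] q s0 s unfolding cL a_def b_def by simp
    have up: "c * (1 - L) \<le> K1 * a\<^sup>2 + K2 * b\<^sup>2"
      using kup[OF r r1] qup[OF s s1] unfolding cL a_def b_def by simp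
    have "0 \<le> c * (1 - L)" using lo k by (meson order_trans mult_nonneg_nonneg less_imp_le zero_le_power2)
    then have L1: "L \<le> 1" using c by (simp add: zero_le_mult_iff)
    have LL: "L\<^sup>2 \<le> L" using L0 L1 by (simp add: power2_eq_square mult_left_le)
    have LL2: "1 - L\<^sup>2 \<le> 2 * (1 - L)"
      using zero_le_power2[of "1 - L"] by (simp add: power2_eq_square algebra_simps)
    have u: "s0 * r - r0 * s = s0 * a - r0 * b" by (simp add: a_def b_def algebra_simps)
    have "s0 powr (q - 1) * \<bar>b\<bar> \<le> \<bar>s powr q - s0 powr q\<bar>"
      unfolding b_def using powr_diff_ge q s0 s by blast
    also have "\<dots> = \<bar>r powr p - r0 powr p\<bar>" using rs r0 s0 by simp
    also have "\<dots> \<le> p * \<bar>a\<bar>" unfolding a_def using powr_diff_le[of p r0 r] p r0 r r1 by simp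
    finally have "\<bar>b\<bar> \<le> E * \<bar>a\<bar>" using s0 by (simp add: E_def field_simps)
    then have "\<bar>b\<bar>\<^sup>2 \<le> (E * \<bar>a\<bar>)\<^sup>2" by (intro power_mono) auto
    then have b2: "b\<^sup>2 \<le> E\<^sup>2 * a\<^sup>2" by (simp add: power_mult_distrib)
    have "(s0 * a - r0 * b)\<^sup>2 \<le> 2 * (s0\<^sup>2 * a\<^sup>2) + 2 * (r0\<^sup>2 * b\<^sup>2)"
      using zero_le_power2[of "s0 * a + r0 * b"] by (simp add: power2_eq_square algebra_simps)
    also have "\<dots> \<le> 2 * (1 * a\<^sup>2) + 2 * (1 * b\<^sup>2)"
      using r0 s0 by (intro add_mono mult_left_mono mult_right_mono) (auto simp: power_le_one)
    also have "\<dots> \<le> 2 * (1 + E\<^sup>2) * a\<^sup>2" using b2 by (simp add: algebra_simps)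
    finally have u2: "(s0 * a - r0 * b)\<^sup>2 \<le> 2 * (1 + E\<^sup>2) * a\<^sup>2" .
    have "t * (s0 * a - r0 * b)\<^sup>2 \<le> k / (2 * c * (1 + E\<^sup>2)) * (2 * (1 + E\<^sup>2) * a\<^sup>2)"
      using t u2 k c by (intro mult_mono) auto
    also have "\<dots> = k * a\<^sup>2 / c" using c E2 by (simp add: divide_simps)
    also have "\<dots> \<le> 1 - L" using lo c by (simp add: field_simps)
    finally have A: "L\<^sup>2 + t * (s0 * a - r0 * b)\<^sup>2 \<le> 1" using LL by linarith
    \<comment> \<open>Both powers are increasing and their sum is fixed, so the coordinates cannot
      move in the same direction. The cross term of \<open>(s0 * a - r0 * b)\<^sup>2\<close> is
      therefore nonnegative.\<close>
    have ab: "a * b \<le> 0"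
    proof (rule ccontr)
      assume "\<not> a * b \<le> 0"
      then consider "r > r0" "s > s0" | "r < r0" "s < s0"
        by (auto simp: not_le zero_less_mult_iff a_def b_def)
      then show False
        using powr_less_mono2[of p r0 r] powr_less_mono2[of q s0 s]
          powr_less_mono2[of p r r0] powr_less_mono2[of q s s0] r0 s0 r s rs p q
        by cases auto
    qed
    have ab': "s0 * r0 * (a * b) \<le> 0" using ab r0 s0 by (simp add: mult_le_0_iff)
    have u3: "s0\<^sup>2 * a\<^sup>2 + r0\<^sup>2 * b\<^sup>2 \<le> (s0 * a - r0 * b)\<^sup>2"
      using ab' by (simp add: power2_eq_square algebra_simps)
    have u4: "s0\<^sup>2 * a\<^sup>2 \<le> (s0 * a - r0 * b)\<^sup>2" "r0\<^sup>2 * b\<^sup>2 \<le> (s0 * a - r0 * b)\<^sup>2"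
      using u3 zero_le_power2[of "s0 * a"] zero_le_power2[of "r0 * b"]
      unfolding power_mult_distrib by linarith+
    have "1 - L\<^sup>2 \<le> 2 * (K1 * a\<^sup>2 + K2 * b\<^sup>2) / c"
    proof -
      have "1 - L \<le> (K1 * a\<^sup>2 + K2 * b\<^sup>2) / c" using up c by (simp add: pos_le_divide_eq mult.commute)
      then have "2 * (1 - L) \<le> 2 * ((K1 * a\<^sup>2 + K2 * b\<^sup>2) / c)" by (intro mult_left_mono) auto
      then show ?thesis using LL2 by (simp only: times_divide_eq_right)
    qed
    also have "\<dots> = 2 * K1 / (c * s0\<^sup>2) * (s0\<^sup>2 * a\<^sup>2) + 2 * K2 / (c * r0\<^sup>2) * (r0\<^sup>2 * b\<^sup>2)"
      using r0 s0 c by (simp add: field_simps)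
    also have "\<dots> \<le> 2 * K1 / (c * s0\<^sup>2) * (s0 * a - r0 * b)\<^sup>2 + 2 * K2 / (c * r0\<^sup>2) * (s0 * a - r0 * b)\<^sup>2"
      using k K2 c u4 by (intro add_mono mult_left_mono) auto
    also have "\<dots> \<le> T * (s0 * a - r0 * b)\<^sup>2"
      unfolding distrib_right[symmetric] using T by (intro mult_right_mono) auto
    finally have "1 \<le> L\<^sup>2 + T * (s0 * a - r0 * b)\<^sup>2" by simp
    then show ?thesis using A unfolding u L_def by simp
  qed
  show ?thesis
    by (rule that[of v1 r0 v2 s0 t T]) (use r0 s0 v t T vx0 main in simp_all)
qed

text \<open>Exchanging the coordinates reduces to a first exponent above 1;
  \<open>s0 * r - r0 * s\<close> only changes sign, and it enters squared.\<close>

lemma curve_between_ellipses: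
  fixes p q :: real
  assumes "p \<ge> 1" "q \<ge> 1" "p > 1 \<or> q > 1"
  obtains v1 r0 v2 s0 t T where
    "v1 * r0 + v2 * s0 = 1" "t * (r0 * s0) \<le> v1 * v2" "v1 * v2 \<le> T * (r0 * s0)"
    "r0 > 0" "s0 > 0" "v1 > 0" "v2 > 0" "t > 0" "T > 0"
    "\<And>r s. r \<ge> 0 \<Longrightarrow> s \<ge> 0 \<Longrightarrow> r powr p + s powr q = 1 \<Longrightarrow>
      (v1 * r + v2 * s)\<^sup>2 + t * (s0 * r - r0 * s)\<^sup>2 \<le> 1"
    "\<And>r s. r \<ge> 0 \<Longrightarrow> s \<ge> 0 \<Longrightarrow> r powr p + s powr q = 1 \<Longrightarrow>
      1 \<le> (v1 * r + v2 * s)\<^sup>2 + T * (s0 * r - r0 * s)\<^sup>2"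
proof (cases "p > 1")
  case True
  show ?thesis by (rule curve_between_ellipses_aux[OF True assms(2)]) (rule that)
next
  case False
  then have "q > 1" using assms by simp
  from this assms(1) obtain v2 s0 v1 r0 t T where *:
    "v2 * s0 + v1 * r0 = 1" "t * (s0 * r0) \<le> v2 * v1" "v2 * v1 \<le> T * (s0 * r0)"
    "s0 > 0" "r0 > 0" "v2 > 0" "v1 > 0" "t > 0" "T > 0"
    and **: "\<And>s r. s \<ge> 0 \<Longrightarrow> r \<ge> 0 \<Longrightarrow> s powr q + r powr p = 1 \<Longrightarrow>
      (v2 * s + v1 * r)\<^sup>2 + t * (r0 * s - s0 * r)\<^sup>2 \<le> 1"
    "\<And>s r. s \<ge> 0 \<Longrightarrow> r \<ge> 0 \<Longrightarrow> s powr q + r powr p = 1 \<Longrightarrow>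
      1 \<le> (v2 * s + v1 * r)\<^sup>2 + T * (r0 * s - s0 * r)\<^sup>2"
    by (rule curve_between_ellipses_aux[of q p]) (rule that)
  have sq: "(r0 * s - s0 * r)\<^sup>2 = (s0 * r - r0 * s)\<^sup>2" for r s
    by (rule power2_commute)
  show ?thesis
  proof (rule that[of v1 r0 v2 s0 t T])
    show "(v1 * r + v2 * s)\<^sup>2 + t * (s0 * r - r0 * s)\<^sup>2 \<le> 1"
      "1 \<le> (v1 * r + v2 * s)\<^sup>2 + T * (s0 * r - r0 * s)\<^sup>2"
      if "r \<ge> 0" "s \<ge> 0" "r powr p + s powr q = 1" for r s
      using **[of s r] that by (simp_all add: sq add.commute)
  qed (use * in \<open>simp_all add: mult.commute add.commute\<close>)
qed

section \<open>Norms with an Auerbach basis and the norm of the ball\<close>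

definition bilin :: "complex ^ 'n \<Rightarrow> complex ^ 'n \<Rightarrow> complex" where
  "bilin l m = (\<Sum>i\<in>UNIV. l $ i * m $ i)"

lemma bilin_commute: "bilin l m = bilin m l"
  by (simp add: bilin_def mult.commute)

lemma bilin_zero [simp]: "bilin 0 m = 0" "bilin l 0 = 0"
  by (simp_all add: bilin_def)

lemma bilin_add_right: "bilin l (m + m') = bilin l m + bilin l m'"
  by (simp add: bilin_def algebra_simps sum.distrib)

lemma bilin_scale_right: "bilin l (c *s m) = c * bilin l m"
  by (simp add: bilin_def sum_distrib_left algebra_simps)

lemma bilin_scaleR_right: "bilin l (r *\<^sub>R m) = of_real r * bilin l m"
  by (simp add: bilin_def sum_distrib_left scaleR_conv_of_real[where 'a = complex] algebra_simps)

lemma bilin_sum_right: "bilin l (sum f I) = (\<Sum>i\<in>I. bilin l (f i))"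
  by (induction I rule: infinite_finite_induct) (auto simp: bilin_add_right)

lemma bilin_axis: "bilin l (axis i 1) = l $ i"
proof -
  have "bilin l (axis i 1) = (\<Sum>j\<in>UNIV. if j = i then l $ j else 0)"
    unfolding bilin_def by (intro sum.cong) (auto simp: axis_def)
  then show ?thesis by simp
qed

lemma bilin_2: "bilin l m = l $ 1 * m $ 1 + l $ 2 * m $ 2" for l m :: "complex ^ 2"
  by (simp add: bilin_def sum_2)

text \<open>The last two conditions say that the standard basis is an Auerbach basis. They give
  definiteness and bound the suprema in the definitions.\<close>

locale norm_on_Cn =
  fixes N :: "complex ^ 'n \<Rightarrow> real"
  assumes scale: "N (c *s x) = cmod c * N x"
    and norming: "\<exists>\<phi>. bilin \<phi> x = of_real (N x) \<and> (\<forall>z. cmod (bilin \<phi> z) \<le> N z)"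
    and component_le: "cmod (x $ i) \<le> N x"
    and axis_le: "N (axis i 1) \<le> 1"
begin

lemma nonneg: "0 \<le> N x"
  using component_le[of x undefined] norm_ge_zero order_trans by blast

lemma zero_iff: "N x = 0 \<longleftrightarrow> x = 0"
proof
  assume "N x = 0"
  then have "x $ i = 0" for i using component_le[of x i] by simp
  then show "x = 0" by (simp add: Finite_Cartesian_Product.vec_eq_iff)
next
  assume "x = 0"
  then show "N x = 0" using scale[of 0 0] by simp
qed

text \<open>Stated by domination, so that no supremum has to be bounded first. With it, the
  assumption \<open>norming\<close> plays the role of the Hahn-Banach theorem.\<close>

definition dual_ball :: "(complex ^ 'n) set" where
  "dual_ball = {\<phi>. \<forall>z. cmod (bilin \<phi> z) \<le> N z}"

lemma norming_dual_ball: obtains \<phi> where "\<phi> \<in> dual_ball" "bilin \<phi> x = of_real (N x)"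
  using norming[of x] by (auto simp: dual_ball_def)

end

lemma cnj_sgn_mult: "cnj (sgn z) * z = of_real (cmod z)"
  by (simp add: sgn_eq complex_norm_square[symmetric] mult.commute[of "cnj z"] power2_eq_square)

section \<open>The norm of the ball, computed on the level set of its defining sum\<close>

definition pq_sum :: "real \<Rightarrow> real \<Rightarrow> complex ^ 2 \<Rightarrow> real" where
  "pq_sum p q z = cmod (z $ 1) powr p + cmod (z $ 2) powr q"

context
  fixes p q :: real
  assumes p: "1 \<le> p" and q: "1 \<le> q"
begin

text \<open>As the exponents are at least 1, \<open>t \<le> t powr e\<close> for
  \<open>t \<ge> 1\<close>. A ray thus crosses the level 1 only once, which determines the Minkowski
  functional.\<close>

lemma pq_sum_shrink_le:
  assumes "1 \<le> t"
  shows "pq_sum p q (x /\<^sub>R t) \<le> pq_sum p q x / t"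
proof -
  have *: "(a / t) powr e \<le> a powr e / t" if "a \<ge> 0" "1 \<le> e" for a e
  proof -
    have "t powr 1 \<le> t powr e" using that assms by (intro powr_mono) auto
    then have "a powr e / t powr e \<le> a powr e / t"
      using assms by (intro divide_left_mono) auto
    then show ?thesis using that assms by (simp add: powr_divide)
  qed
  have "cmod ((x /\<^sub>R t) $ i) = cmod (x $ i) / t" for i
    using assms by (simp add: divide_inverse mult.commute)
  then show ?thesis
    using *[of "cmod (x $ 1)" p] *[of "cmod (x $ 2)" q] p q
    by (simp add: pq_sum_def add_divide_distrib)
qed

lemma norm_Bpq_eqI:
  assumes y: "pq_sum p q y = 1" and "r > 0"
  shows "norm_Bpq p q (r *\<^sub>R y) = r"
proof -
  have "{t. 0 < t \<and> (r *\<^sub>R y) /\<^sub>R t \<in> Bpq p q} = {r<..}"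
  proof (intro equalityI subsetI)
    fix t assume "t \<in> {t. 0 < t \<and> (r *\<^sub>R y) /\<^sub>R t \<in> Bpq p q}"
    then have t: "0 < t" and lt: "pq_sum p q ((r *\<^sub>R y) /\<^sub>R t) < 1"
      by (auto simp: Bpq_def pq_sum_def)
    have "\<not> t \<le> r"
    proof
      assume "t \<le> r"
      then have "1 \<le> r / t" using t by simp
      then have "pq_sum p q (((r *\<^sub>R y) /\<^sub>R t) /\<^sub>R (r / t)) \<le> pq_sum p q ((r *\<^sub>R y) /\<^sub>R t) / (r / t)"
        by (rule pq_sum_shrink_le)
      also have "((r *\<^sub>R y) /\<^sub>R t) /\<^sub>R (r / t) = y"
        using t \<open>r > 0\<close> by simp
      finally have "r / t \<le> pq_sum p q ((r *\<^sub>R y) /\<^sub>R t)"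
        using y t \<open>r > 0\<close> by (simp add: field_simps)
      then show False using lt \<open>1 \<le> r / t\<close> by linarith
    qed
    then show "t \<in> {r<..}" by simp
  next
    fix t assume t: "t \<in> {r<..}"
    then have "1 \<le> t / r" using \<open>r > 0\<close> by simp
    then have "pq_sum p q (y /\<^sub>R (t / r)) \<le> 1 / (t / r)"
      using pq_sum_shrink_le y by metis
    also have "\<dots> < 1" using t \<open>r > 0\<close> by simp
    also have "y /\<^sub>R (t / r) = (r *\<^sub>R y) /\<^sub>R t"
      using t \<open>r > 0\<close> by (simp add: divide_inverse mult.commute)
    finally show "t \<in> {t. 0 < t \<and> (r *\<^sub>R y) /\<^sub>R t \<in> Bpq p q}"
      using t \<open>r > 0\<close> by (auto simp: Bpq_def pq_sum_def)
  qed
  then show ?thesis by (simp add: norm_Bpq_def minkowski_functional_def)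
qed

lemma norm_Bpq_zero: "norm_Bpq p q 0 = 0"
proof -
  have "{t. 0 < t \<and> (0 :: complex ^ 2) /\<^sub>R t \<in> Bpq p q} = {0<..}"
    using p q by (auto simp: Bpq_def)
  then show ?thesis by (simp add: norm_Bpq_def minkowski_functional_def)
qed

text \<open>The intermediate value theorem finds the level 1 on the ray through \<open>x\<close>,
  between 0 and the multiple by \<open>M\<close> that gives a nonzero coordinate modulus 1.\<close>

lemma norm_Bpq_polar:
  assumes "x \<noteq> 0"
  obtains r y where "r > 0" "pq_sum p q y = 1" "x = r *\<^sub>R y" "norm_Bpq p q x = r"
proof -
  obtain i where i: "x $ i \<noteq> 0" using assms by (auto simp: Finite_Cartesian_Product.vec_eq_iff)
  define M where "M = 1 / cmod (x $ i)"
  have M: "M \<ge> 0" by (simp add: M_def)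
  have "i = 1 \<or> i = 2" by (rule exhaust_2)
  then have big: "1 \<le> pq_sum p q (M *\<^sub>R x)"
    using i p q by (auto simp: pq_sum_def M_def)
  have small: "pq_sum p q (0 *\<^sub>R x) \<le> 1" by (simp add: pq_sum_def)
  have "continuous_on {0..M} (\<lambda>t. pq_sum p q (t *\<^sub>R x))"
    unfolding pq_sum_def using p q by (intro continuous_intros continuous_on_powr') auto
  then obtain t where t: "0 \<le> t" "pq_sum p q (t *\<^sub>R x) = 1"
    using IVT'[of "\<lambda>t. pq_sum p q (t *\<^sub>R x)" 0 1 M] small big M by auto
  have "t \<noteq> 0"
    using t(2) by (auto simp: pq_sum_def)
  then have "t > 0" "x = (1 / t) *\<^sub>R (t *\<^sub>R x)" using t by auto
  then show ?thesis using that[of "1 / t" "t *\<^sub>R x"] norm_Bpq_eqI[of "t *\<^sub>R x" "1 / t"] t(2) by auto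
qed

lemma norm_Bpq_scale: "norm_Bpq p q (c *s x) = cmod c * norm_Bpq p q x"
proof (cases "c = 0 \<or> x = 0")
  case True
  then show ?thesis by (auto simp: norm_Bpq_zero)
next
  case False
  then have "x \<noteq> 0" by simp
  then obtain r y where r: "r > 0" "pq_sum p q y = 1" "x = r *\<^sub>R y" "norm_Bpq p q x = r"
    by (rule norm_Bpq_polar)
  have "pq_sum p q (sgn c *s y) = 1"
    using r(2) False by (simp add: pq_sum_def norm_mult norm_sgn)
  moreover have "c *s x = (cmod c * r) *\<^sub>R (sgn c *s y)"
    using False unfolding r(3) Finite_Cartesian_Product.vec_eq_iff
    by (simp add: sgn_div_norm scaleR_conv_of_real[where 'a = complex] field_simps)
  ultimately show ?thesis
    using norm_Bpq_eqI[of "sgn c *s y" "cmod c * r"] r False by simp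
qed

text \<open>Reduces norm estimates to the level set, where the powers can be used directly;
  \<open>pq_sum\<close> itself is not homogeneous in general.\<close>

lemma norm_Bpq_homogeneous_le:
  assumes "\<And>z. pq_sum p q z = 1 \<Longrightarrow> g z \<le> 1"
    and "g 0 = 0" and "\<And>r z. r > 0 \<Longrightarrow> g (r *\<^sub>R z) = r * g z"
  shows "g x \<le> norm_Bpq p q x"
proof (cases "x = 0")
  case True
  then show ?thesis using assms(2) norm_Bpq_zero by simp
next
  case False
  then obtain r y where "r > 0" "pq_sum p q y = 1" "x = r *\<^sub>R y" "norm_Bpq p q x = r"
    by (rule norm_Bpq_polar)
  then show ?thesis using assms(1)[of y] assms(3)[of r y] by simp
qed

lemma norm_Bpq_nonneg: "0 \<le> norm_Bpq p q x"
  by (rule norm_Bpq_homogeneous_le[where g = "\<lambda>_. 0"]) auto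

lemma pq_sum_component_le: "pq_sum p q z = 1 \<Longrightarrow> cmod (z $ i) \<le> 1"
  using exhaust_2[of i] p q le_one_if_powr_le_one[of "cmod (z $ 1)" p]
    le_one_if_powr_le_one[of "cmod (z $ 2)" q]
    powr_ge_zero[of "cmod (z $ 1)" p] powr_ge_zero[of "cmod (z $ 2)" q]
  unfolding pq_sum_def by force

text \<open>The norming functional at a point of the unit sphere is the normalised gradient of
  \<open>|z\<^sub>1|\<^sup>p + |z\<^sub>2|\<^sup>q\<close>. At a vanishing coordinate its component is zero, also when the exponent is 1,
  because \<open>sgn 0 = 0\<close>.\<close>

lemma pq_sum_norming:
  assumes x: "pq_sum p q x = 1"
  shows "\<exists>\<phi>. bilin \<phi> x = 1 \<and> (\<forall>z. cmod (bilin \<phi> z) \<le> norm_Bpq p q z)"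
proof -
  define a b where "a = cmod (x $ 1)" and "b = cmod (x $ 2)"
  have ab: "a powr p + b powr q = 1" "a \<ge> 0" "b \<ge> 0"
    using x by (auto simp: pq_sum_def a_def b_def)
  define c where "c = p * a powr p + q * b powr q"
  have "a powr p + b powr q \<le> c"
    unfolding c_def using p q by (intro add_mono) (auto simp: mult_le_cancel_right1)
  then have c: "c \<ge> 1" using ab by simp
  define \<phi> :: "complex ^ 2" where "\<phi> = vector [of_real (p * a powr (p - 1) / c) * cnj (sgn (x $ 1)),
    of_real (q * b powr (q - 1) / c) * cnj (sgn (x $ 2))]"
  have phi: "\<phi> $ 1 = of_real (p * a powr (p - 1) / c) * cnj (sgn (x $ 1))"
      "\<phi> $ 2 = of_real (q * b powr (q - 1) / c) * cnj (sgn (x $ 2))"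
    by (simp_all add: \<phi>_def)
  have e: "u powr (d - 1) * u = u powr d" if "u \<ge> 0" for u d :: real
    using that powr_mult_base[of u "d - 1"] by (simp add: mult.commute)
  have "bilin \<phi> x = of_real (p * a powr (p - 1) / c) * (cnj (sgn (x $ 1)) * x $ 1) +
      of_real (q * b powr (q - 1) / c) * (cnj (sgn (x $ 2)) * x $ 2)"
    unfolding bilin_2 phi by (simp add: mult.assoc)
  also have "\<dots> = of_real (p * a powr (p - 1) / c * a + q * b powr (q - 1) / c * b)"
    unfolding cnj_sgn_mult a_def b_def by simp
  also have "p * a powr (p - 1) / c * a + q * b powr (q - 1) / c * b =
      (p * (a powr (p - 1) * a) + q * (b powr (q - 1) * b)) / c"
    by (simp add: add_divide_distrib)
  also have "\<dots> = 1" using c ab by (simp add: e c_def[symmetric])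
  finally have 1: "bilin \<phi> x = 1" by simp
  have "cmod (bilin \<phi> z) \<le> norm_Bpq p q z" for z
  proof (rule norm_Bpq_homogeneous_le)
    fix z :: "complex ^ 2" assume z: "pq_sum p q z = 1"
    have ns: "cmod (sgn w) \<le> 1" for w :: complex by (simp add: norm_sgn)
    have n1: "cmod (\<phi> $ 1) \<le> p * a powr (p - 1) / c"
      unfolding phi norm_mult complex_mod_cnj using c p ns[of "x $ 1"]
      by (simp add: norm_divide norm_mult divide_right_mono mult_left_le)
    have n2: "cmod (\<phi> $ 2) \<le> q * b powr (q - 1) / c"
      unfolding phi norm_mult complex_mod_cnj using c q ns[of "x $ 2"]
      by (simp add: norm_divide norm_mult divide_right_mono mult_left_le)
    have "cmod (bilin \<phi> z) \<le> cmod (\<phi> $ 1) * cmod (z $ 1) + cmod (\<phi> $ 2) * cmod (z $ 2)"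
      unfolding bilin_2 by (metis norm_mult norm_triangle_ineq)
    also have "\<dots> \<le> p * a powr (p - 1) / c * cmod (z $ 1) + q * b powr (q - 1) / c * cmod (z $ 2)"
      using n1 n2 by (intro add_mono mult_right_mono) auto
    \<comment> \<open>Recentring at \<open>(a, b)\<close> exposes tangent increments, which
      convexity bounds by increments of the powers; what remains sums to \<open>c\<close>.\<close>
    also have "\<dots> = (p * a powr (p - 1) * (cmod (z $ 1) - a) + q * b powr (q - 1) * (cmod (z $ 2) - b)
        + (p * (a powr (p - 1) * a) + q * (b powr (q - 1) * b))) / c"
      using c by (simp add: field_simps)
    also have "\<dots> \<le> ((cmod (z $ 1) powr p - a powr p) + (cmod (z $ 2) powr q - b powr q) + c) / c"
      using c p q ab by (intro divide_right_mono add_mono powr_ge_tangent) (auto simp: e c_def)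
    also have "\<dots> = 1" using z ab c by (simp add: pq_sum_def)
    finally show "cmod (bilin \<phi> z) \<le> 1" .
  next
    fix r :: real and z :: "complex ^ 2" assume "r > 0"
    then show "cmod (bilin \<phi> (r *\<^sub>R z)) = r * cmod (bilin \<phi> z)"
      by (simp add: bilin_scaleR_right norm_mult)
  qed simp
  then show ?thesis using 1 by blast
qed

lemma norm_on_Cn_norm_Bpq: "norm_on_Cn (norm_Bpq p q)"
proof
  fix x :: "complex ^ 2" and i :: 2 and c :: complex
  show "norm_Bpq p q (c *s x) = cmod c * norm_Bpq p q x" by (rule norm_Bpq_scale)
  show "\<exists>\<phi>. bilin \<phi> x = of_real (norm_Bpq p q x) \<and> (\<forall>z. cmod (bilin \<phi> z) \<le> norm_Bpq p q z)"
  proof (cases "x = 0")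
    case True
    then show ?thesis by (intro exI[of _ 0]) (simp add: norm_Bpq_zero norm_Bpq_nonneg)
  next
    case False
    then obtain r y where r: "r > 0" "pq_sum p q y = 1" "x = r *\<^sub>R y" "norm_Bpq p q x = r"
      by (rule norm_Bpq_polar)
    obtain \<phi> where \<phi>: "bilin \<phi> y = 1" "\<forall>z. cmod (bilin \<phi> z) \<le> norm_Bpq p q z"
      using pq_sum_norming[OF r(2)] by blast
    have "x = of_real r *s y" 
      unfolding r(3) Finite_Cartesian_Product.vec_eq_iff
      by (simp add: scaleR_conv_of_real[where 'a = complex])
    then have "bilin \<phi> x = of_real r" using \<phi> by (simp add: bilin_scale_right)
    then show ?thesis using \<phi> r by auto
  qed
  show "cmod (x $ i) \<le> norm_Bpq p q x"
    by (rule norm_Bpq_homogeneous_le) (auto intro: pq_sum_component_le)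
  have "pq_sum p q (axis i 1) = 1"
    using exhaust_2[of i] p q by (auto simp: pq_sum_def axis_def)
  then show "norm_Bpq p q (axis i 1) \<le> 1"
    using norm_Bpq_eqI[of "axis i 1" 1] by simp
qed

end

section \<open>Operator space structures from column contractions\<close>

lemma l2_norm_nonneg [simp]: "0 \<le> l2_norm v"
  by (simp add: l2_norm_def L2_set_nonneg)

lemma l2_norm_le_sum: "l2_norm v \<le> (\<Sum>i<dim_vec v. cmod (vec_index v i))"
  unfolding l2_norm_def by (rule L2_set_le_sum) simp

lemma component_le_l2_norm: "i < dim_vec v \<Longrightarrow> cmod (vec_index v i) \<le> l2_norm v"
  unfolding l2_norm_def by (rule member_le_L2_set) auto

lemma l2_norm_triangle:
  assumes "u \<in> carrier_vec n" "v \<in> carrier_vec n"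
  shows "l2_norm (u + v) \<le> l2_norm u + l2_norm v"
proof -
  have "l2_norm (u + v) \<le> L2_set (\<lambda>i. cmod (vec_index u i) + cmod (vec_index v i)) {..<n}"
    unfolding l2_norm_def using assms by (auto intro!: L2_set_mono norm_triangle_ineq)
  also have "\<dots> \<le> l2_norm u + l2_norm v"
    using L2_set_triangle_ineq assms unfolding l2_norm_def by auto
  finally show ?thesis .
qed

lemma l2_norm_smult [simp]: "l2_norm (c \<cdot>\<^sub>v v) = cmod c * l2_norm v"
  unfolding l2_norm_def by (simp add: norm_mult L2_set_right_distrib cong: L2_set_cong_simp)

lemma l2_norm_append: "(l2_norm (u @\<^sub>v v))\<^sup>2 = (l2_norm u)\<^sup>2 + (l2_norm v)\<^sup>2"
proof -
  have split: "(\<Sum>i<a + b. g i) = (\<Sum>i<a. g i) + (\<Sum>i<b. g (a + i))" for a b and g :: "nat \<Rightarrow> real"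
    by (induction b) auto
  have "(\<Sum>i<dim_vec u + dim_vec v. (cmod (vec_index (u @\<^sub>v v) i))\<^sup>2) =
      (\<Sum>i<dim_vec u. (cmod (vec_index (u @\<^sub>v v) i))\<^sup>2) +
      (\<Sum>i<dim_vec v. (cmod (vec_index (u @\<^sub>v v) (dim_vec u + i)))\<^sup>2)"
    by (rule split)
  also have "\<dots> = (\<Sum>i<dim_vec u. (cmod (vec_index u i))\<^sup>2) + (\<Sum>i<dim_vec v. (cmod (vec_index v i))\<^sup>2)"
    by simp
  finally show ?thesis
    by (simp add: l2_norm_def L2_set_def sum_nonneg)
qed

lemma l2_norm_eq_0D: "l2_norm v = 0 \<Longrightarrow> i < dim_vec v \<Longrightarrow> vec_index v i = 0"
  using component_le_l2_norm[of i v] by simp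

lemma l2_norm_unit_vec [simp]: "i < n \<Longrightarrow> l2_norm (unit_vec n i) = 1"
proof -
  assume "i < n"
  have "(\<Sum>j<n. (cmod (vec_index (unit_vec n i) j))\<^sup>2) = (\<Sum>j<n. if j = i then 1 else 0)"
    by (intro sum.cong) (auto simp: unit_vec_def)
  then show ?thesis using \<open>i < n\<close> by (simp add: l2_norm_def L2_set_def)
qed

lemma l2_norm_zero_vec [simp]: "l2_norm (0\<^sub>v n) = 0"
  by (simp add: l2_norm_def L2_set_def)

lemma l2_norm_normalize:
  assumes "v \<in> carrier_vec n"
  obtains u where "u \<in> carrier_vec n" "l2_norm u \<le> 1" "v = of_real (l2_norm v) \<cdot>\<^sub>v u"
proof (cases "l2_norm v = 0")
  case True
  then have "v = 0\<^sub>v n" using assms l2_norm_eq_0D[of v] by (intro eq_vecI) auto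
  then show ?thesis using True by (intro that[of "0\<^sub>v n"]) auto
next
  case False
  define u where "u = of_real (1 / l2_norm v) \<cdot>\<^sub>v v"
  have "l2_norm u = cmod (of_real (1 / l2_norm v)) * l2_norm v" unfolding u_def by (rule l2_norm_smult)
  also have "\<dots> = 1" using False by (simp only: norm_of_real) simp
  finally have "l2_norm u \<le> 1" by simp
  moreover have "v = of_real (l2_norm v) \<cdot>\<^sub>v u"
    using False by (simp add: u_def smult_smult_assoc)
  ultimately show ?thesis using assms that[of u] by (simp add: u_def)
qed

lemma cmod_mult_mat_vec_le:
  assumes "A \<in> carrier_mat n m" "v \<in> carrier_vec m" "l2_norm v \<le> 1" "i < n"
  shows "cmod (vec_index (A *\<^sub>v v) i) \<le> (\<Sum>j<m. cmod (A $$ (i, j)))"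
proof -
  have "vec_index (A *\<^sub>v v) i = (\<Sum>j<m. A $$ (i, j) * vec_index v j)"
    using assms by (simp add: scalar_prod_def lessThan_atLeast0)
  also have "cmod \<dots> \<le> (\<Sum>j<m. cmod (A $$ (i, j)) * cmod (vec_index v j))"
    by (rule order_trans[OF norm_sum]) (simp add: norm_mult)
  also have "\<dots> \<le> (\<Sum>j<m. cmod (A $$ (i, j)))"
    using assms component_le_l2_norm[of _ v] by (intro sum_mono mult_left_le) (auto intro: order_trans)
  finally show ?thesis .
qed

text \<open>A crude bound, enough to show that suprema over the Euclidean unit ball are bounded
  above.\<close>

lemma l2_norm_mult_mat_vec_le_sum:
  assumes "A \<in> carrier_mat n m" "v \<in> carrier_vec m" "l2_norm v \<le> 1"
  shows "l2_norm (A *\<^sub>v v) \<le> (\<Sum>i<n. \<Sum>j<m. cmod (A $$ (i, j)))"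
proof -
  have "l2_norm (A *\<^sub>v v) \<le> (\<Sum>i<n. cmod (vec_index (A *\<^sub>v v) i))"
    using l2_norm_le_sum[of "A *\<^sub>v v"] assms(1) by simp
  also have "\<dots> \<le> (\<Sum>i<n. \<Sum>j<m. cmod (A $$ (i, j)))"
    using assms by (intro sum_mono cmod_mult_mat_vec_le) auto
  finally show ?thesis .
qed

lemma l2_norm_mult_mat_vec_le:
  assumes A: "A \<in> carrier_mat n m" and v: "v \<in> carrier_vec m"
  shows "l2_norm (A *\<^sub>v v) \<le> l2_op_norm A * l2_norm v"
proof -
  obtain u where u: "u \<in> carrier_vec m" "l2_norm u \<le> 1" "v = of_real (l2_norm v) \<cdot>\<^sub>v u"
    using l2_norm_normalize[OF v] by blast
  have "l2_norm (A *\<^sub>v u) \<le> l2_op_norm A"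
    unfolding l2_op_norm_def
  proof (rule cSup_upper)
    show "bdd_above {l2_norm (A *\<^sub>v v) |v. v \<in> carrier_vec (dim_col A) \<and> l2_norm v \<le> 1}"
      using l2_norm_mult_mat_vec_le_sum[OF A] A by (auto simp: bdd_above_def)
  qed (use u A in auto)
  moreover have "A *\<^sub>v v = of_real (l2_norm v) \<cdot>\<^sub>v (A *\<^sub>v u)"
    by (subst u(3)) (rule mult_mat_vec[OF A u(1)])
  ultimately show ?thesis
    by (simp add: mult.commute mult_left_mono)
qed

lemma l2_op_norm_nonneg:
  assumes "A \<in> carrier_mat n m" "m \<ge> 1"
  shows "0 \<le> l2_op_norm A"
proof -
  have "0 \<le> l2_norm (A *\<^sub>v unit_vec m 0)" by simp
  also have "\<dots> \<le> l2_op_norm A * l2_norm (unit_vec m 0)"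
    by (rule l2_norm_mult_mat_vec_le[OF assms(1)]) simp
  finally show ?thesis using assms(2) by simp
qed

text \<open>By linearity of the functional, the bimodule action becomes an ordinary matrix
  product.\<close>

lemma map_mat_bimod_mult:
  assumes "A \<in> carrier_mat n m" "C \<in> carrier_mat m m" "B \<in> carrier_mat m n"
  shows "map_mat (bilin \<phi>) (bimod_mult A C B) = A * map_mat (bilin \<phi>) C * B"
proof (rule eq_matI)
  fix i j assume "i < dim_row (A * map_mat (bilin \<phi>) C * B)" "j < dim_col (A * map_mat (bilin \<phi>) C * B)"
  then have ij: "i < n" "j < n" using assms by auto
  have "(A * map_mat (bilin \<phi>) C * B) $$ (i, j) =
      (\<Sum>k<m. A $$ (i, k) * (\<Sum>l<m. bilin \<phi> (C $$ (k, l)) * B $$ (l, j)))"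
    using assms ij by (simp add: scalar_prod_def lessThan_atLeast0)
  also have "\<dots> = (\<Sum>k<m. \<Sum>l<m. A $$ (i, k) * B $$ (l, j) * bilin \<phi> (C $$ (k, l)))"
    unfolding sum_distrib_left by (simp add: mult_ac)
  also have "\<dots> = map_mat (bilin \<phi>) (bimod_mult A C B) $$ (i, j)"
    using assms ij by (simp add: bimod_mult_def bilin_sum_right bilin_scale_right)
  finally show "map_mat (bilin \<phi>) (bimod_mult A C B) $$ (i, j) = (A * map_mat (bilin \<phi>) C * B) $$ (i, j)" ..
qed (use assms in \<open>auto simp: bimod_mult_def\<close>)

text \<open>A pair of functionals is a linear map from \<open>X\<close> to the column space \<open>M\<^sub>2\<^sub>,\<^sub>1\<close>; applying it
  entrywise to \<open>C\<close> gives a \<open>2n \<times> n\<close> matrix, whose action on \<open>\<xi>\<close> is measured here.\<close>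

definition column_value ::
    "(complex ^ 'n) \<times> (complex ^ 'n) \<Rightarrow> (complex ^ 'n) Matrix.mat \<Rightarrow> complex Matrix.vec \<Rightarrow> real" where
  "column_value f C \<xi> = sqrt ((l2_norm (map_mat (bilin (fst f)) C *\<^sub>v \<xi>))\<^sup>2 +
     (l2_norm (map_mat (bilin (snd f)) C *\<^sub>v \<xi>))\<^sup>2)"

text \<open>For fixed \<open>f\<close> the supremum over \<open>\<xi>\<close> is the operator norm
  of the \<open>2n\<close> by \<open>n\<close> matrix.\<close>

definition column_norm ::
    "((complex ^ 'n) \<times> (complex ^ 'n)) set \<Rightarrow> nat \<Rightarrow> (complex ^ 'n) Matrix.mat \<Rightarrow> real" where
  "column_norm S n C = Sup {column_value f C \<xi> |f \<xi>. f \<in> S \<and> \<xi> \<in> carrier_vec n \<and> l2_norm \<xi> \<le> 1}"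

lemma column_value_nonneg [simp]: "0 \<le> column_value f C \<xi>"
  by (simp add: column_value_def)

lemma column_value_smult:
  assumes "C \<in> carrier_mat n n" "\<xi> \<in> carrier_vec n"
  shows "column_value f C (c \<cdot>\<^sub>v \<xi>) = cmod c * column_value f C \<xi>"
proof -
  have "map_mat (bilin \<phi>) C *\<^sub>v (c \<cdot>\<^sub>v \<xi>) = c \<cdot>\<^sub>v (map_mat (bilin \<phi>) C *\<^sub>v \<xi>)" for \<phi>
    using assms by (intro mult_mat_vec[of _ n n]) auto
  then show ?thesis
    by (simp add: column_value_def power_mult_distrib distrib_left[symmetric] real_sqrt_mult)
qed

lemma column_value_scale:
  assumes "C \<in> carrier_mat n n" "\<xi> \<in> carrier_vec n"
  shows "column_value f (map_mat ((*s) c) C) \<xi> = cmod c * column_value f C \<xi>"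
proof -
  have "map_mat (bilin \<phi>) (map_mat ((*s) c) C) *\<^sub>v \<xi> = c \<cdot>\<^sub>v (map_mat (bilin \<phi>) C *\<^sub>v \<xi>)" for \<phi>
    using assms
    by (intro eq_vecI) (auto simp: scalar_prod_def bilin_scale_right sum_distrib_left mult.assoc)
  then show ?thesis
    by (simp add: column_value_def power_mult_distrib distrib_left[symmetric] real_sqrt_mult)
qed

lemma column_value_add:
  assumes "C \<in> carrier_mat n n" "D \<in> carrier_mat n n" "\<xi> \<in> carrier_vec n"
  shows "column_value f (C + D) \<xi> \<le> column_value f C \<xi> + column_value f D \<xi>"
proof -
  have "l2_norm (map_mat (bilin \<phi>) (C + D) *\<^sub>v \<xi>) \<le>
      l2_norm (map_mat (bilin \<phi>) C *\<^sub>v \<xi>) + l2_norm (map_mat (bilin \<phi>) D *\<^sub>v \<xi>)" for \<phi>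
  proof -
    have "map_mat (bilin \<phi>) (C + D) = map_mat (bilin \<phi>) C + map_mat (bilin \<phi>) D"
      using assms by (intro eq_matI) (auto simp: bilin_add_right)
    then have "map_mat (bilin \<phi>) (C + D) *\<^sub>v \<xi> = map_mat (bilin \<phi>) C *\<^sub>v \<xi> + map_mat (bilin \<phi>) D *\<^sub>v \<xi>"
      using assms by (simp add: add_mult_distrib_mat_vec[of _ n n])
    then show ?thesis using assms by (auto intro!: l2_norm_triangle[of _ n] mult_mat_vec_carrier)
  qed
  then have "column_value f (C + D) \<xi> \<le>
      sqrt ((l2_norm (map_mat (bilin (fst f)) C *\<^sub>v \<xi>) + l2_norm (map_mat (bilin (fst f)) D *\<^sub>v \<xi>))\<^sup>2 +
        (l2_norm (map_mat (bilin (snd f)) C *\<^sub>v \<xi>) + l2_norm (map_mat (bilin (snd f)) D *\<^sub>v \<xi>))\<^sup>2)"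
    unfolding column_value_def by (intro real_sqrt_le_mono add_mono power_mono) auto
  also have "\<dots> \<le> column_value f C \<xi> + column_value f D \<xi>"
    unfolding column_value_def by (rule real_sqrt_sum_squares_triangle_ineq)
  finally show ?thesis .
qed

text \<open>Functionals vanish on the zero blocks, so each image splits into orthogonal pieces and
  the squares add.\<close>

lemma column_value_dsum:
  assumes A: "A \<in> carrier_mat n n" and B: "B \<in> carrier_mat m m"
    and a: "a \<in> carrier_vec n" and b: "b \<in> carrier_vec m"
  shows "(column_value f (mat_dsum A B) (a @\<^sub>v b))\<^sup>2 = (column_value f A a)\<^sup>2 + (column_value f B b)\<^sup>2"
proof -
  have "map_mat (bilin \<phi>) (mat_dsum A B) *\<^sub>v (a @\<^sub>v b) =
      (map_mat (bilin \<phi>) A *\<^sub>v a) @\<^sub>v (map_mat (bilin \<phi>) B *\<^sub>v b)" for \<phi>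
  proof -
    have "map_mat (bilin \<phi>) (mat_dsum A B) =
        four_block_mat (map_mat (bilin \<phi>) A) (0\<^sub>m n m) (0\<^sub>m m n) (map_mat (bilin \<phi>) B)"
      unfolding mat_dsum_def using A B
      by (intro eq_matI) auto
    then show ?thesis using A B a b by (simp add: mult_mat_vec_split[of _ n _ m])
  qed
  then show ?thesis by (simp add: column_value_def l2_norm_append)
qed

text \<open>On the column, \<open>A\<close> acts separately on both halves, so its operator norm
  factors out once.\<close>

lemma column_value_bimod_mult:
  assumes "A \<in> carrier_mat n m" "C \<in> carrier_mat m m" "B \<in> carrier_mat m n" "\<xi> \<in> carrier_vec n" "m \<ge> 1"
  shows "column_value f (bimod_mult A C B) \<xi> \<le> l2_op_norm A * column_value f C (B *\<^sub>v \<xi>)"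
proof -
  have "(l2_norm (map_mat (bilin \<phi>) (bimod_mult A C B) *\<^sub>v \<xi>))\<^sup>2 \<le>
      (l2_op_norm A)\<^sup>2 * (l2_norm (map_mat (bilin \<phi>) C *\<^sub>v (B *\<^sub>v \<xi>)))\<^sup>2" for \<phi>
  proof -
    have "map_mat (bilin \<phi>) (bimod_mult A C B) *\<^sub>v \<xi> = A * map_mat (bilin \<phi>) C * B *\<^sub>v \<xi>"
      using map_mat_bimod_mult[OF assms(1-3)] by simp
    also have "\<dots> = A * map_mat (bilin \<phi>) C *\<^sub>v (B *\<^sub>v \<xi>)"
      using assms by (intro assoc_mult_mat_vec[of _ n m _ n]) auto
    also have "\<dots> = A *\<^sub>v (map_mat (bilin \<phi>) C *\<^sub>v (B *\<^sub>v \<xi>))"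
      using assms by (intro assoc_mult_mat_vec[of _ n m _ m]) auto
    finally have "l2_norm (map_mat (bilin \<phi>) (bimod_mult A C B) *\<^sub>v \<xi>) \<le>
        l2_op_norm A * l2_norm (map_mat (bilin \<phi>) C *\<^sub>v (B *\<^sub>v \<xi>))"
      using assms l2_norm_mult_mat_vec_le[OF assms(1), of "map_mat (bilin \<phi>) C *\<^sub>v (B *\<^sub>v \<xi>)"] by auto
    then have "(l2_norm (map_mat (bilin \<phi>) (bimod_mult A C B) *\<^sub>v \<xi>))\<^sup>2 \<le>
        (l2_op_norm A * l2_norm (map_mat (bilin \<phi>) C *\<^sub>v (B *\<^sub>v \<xi>)))\<^sup>2"
      by (intro power_mono) auto
    then show ?thesis by (simp add: power_mult_distrib)
  qed
  then have "column_value f (bimod_mult A C B) \<xi> \<le>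
      sqrt ((l2_op_norm A)\<^sup>2 * (l2_norm (map_mat (bilin (fst f)) C *\<^sub>v (B *\<^sub>v \<xi>)))\<^sup>2 +
        (l2_op_norm A)\<^sup>2 * (l2_norm (map_mat (bilin (snd f)) C *\<^sub>v (B *\<^sub>v \<xi>)))\<^sup>2)"
    unfolding column_value_def by (intro real_sqrt_le_mono add_mono)
  also have "\<dots> = l2_op_norm A * column_value f C (B *\<^sub>v \<xi>)"
    using l2_op_norm_nonneg[OF assms(1,5)]
    by (simp add: column_value_def distrib_left[symmetric] real_sqrt_mult)
  finally show ?thesis .
qed

section \<open>Operator space structures from a set of column contractions\<close>

context norm_on_Cn
begin

definition column_contractions :: "((complex ^ 'n) \<times> (complex ^ 'n)) set" where
  "column_contractions = {f. \<forall>z. (cmod (bilin (fst f) z))\<^sup>2 + (cmod (bilin (snd f) z))\<^sup>2 \<le> (N z)\<^sup>2}"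

lemma column_contractions_le:
  assumes "f \<in> column_contractions"
  shows "cmod (bilin (fst f) z) \<le> N z" "cmod (bilin (snd f) z) \<le> N z"
proof -
  have "(cmod (bilin (fst f) z))\<^sup>2 + (cmod (bilin (snd f) z))\<^sup>2 \<le> (N z)\<^sup>2"
    using assms by (simp add: column_contractions_def)
  then have "(cmod (bilin (fst f) z))\<^sup>2 \<le> (N z)\<^sup>2" "(cmod (bilin (snd f) z))\<^sup>2 \<le> (N z)\<^sup>2"
    using zero_le_power2[of "cmod (bilin (fst f) z)"] zero_le_power2[of "cmod (bilin (snd f) z)"]
    by linarith+
  then show "cmod (bilin (fst f) z) \<le> N z" "cmod (bilin (snd f) z) \<le> N z"
    using nonneg by (auto intro: power2_le_imp_le)
qed

lemma dual_ball_column: "\<phi> \<in> dual_ball \<Longrightarrow> (\<phi>, 0) \<in> column_contractions"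
  by (auto simp: dual_ball_def column_contractions_def intro: power_mono)

lemma column_value_le_sum:
  assumes "f \<in> column_contractions" "C \<in> carrier_mat n n" "\<xi> \<in> carrier_vec n" "l2_norm \<xi> \<le> 1"
  shows "column_value f C \<xi> \<le> 2 * (\<Sum>i<n. \<Sum>j<n. N (C $$ (i, j)))"
proof -
  have *: "l2_norm (map_mat (bilin \<phi>) C *\<^sub>v \<xi>) \<le> (\<Sum>i<n. \<Sum>j<n. N (C $$ (i, j)))"
    if "\<And>z. cmod (bilin \<phi> z) \<le> N z" for \<phi>
  proof -
    have "l2_norm (map_mat (bilin \<phi>) C *\<^sub>v \<xi>) \<le> (\<Sum>i<n. \<Sum>j<n. cmod (map_mat (bilin \<phi>) C $$ (i, j)))"
      using assms by (intro l2_norm_mult_mat_vec_le_sum) auto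
    also have "\<dots> \<le> (\<Sum>i<n. \<Sum>j<n. N (C $$ (i, j)))"
      using assms that by (intro sum_mono) auto
    finally show ?thesis .
  qed
  have "column_value f C \<xi> \<le> l2_norm (map_mat (bilin (fst f)) C *\<^sub>v \<xi>) + l2_norm (map_mat (bilin (snd f)) C *\<^sub>v \<xi>)"
    unfolding column_value_def by (rule sqrt_sum_squares_le_sum) auto
  then show ?thesis
    using *[of "fst f"] *[of "snd f"] column_contractions_le[OF assms(1)] by fastforce
qed

text \<open>The choice \<open>S = dual_ball \<times> {0}\<close> gives \<open>MIN\<close>; any further column contraction in \<open>S\<close> can only
  enlarge the matrix norms.\<close>

context
  fixes S
  assumes S: "dual_ball \<times> {0} \<subseteq> S" "S \<subseteq> column_contractions"
begin

lemma column_value_le: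
  assumes f: "f \<in> S" and C: "C \<in> carrier_mat n n" and \<xi>: "\<xi> \<in> carrier_vec n"
  shows "column_value f C \<xi> \<le> column_norm S n C * l2_norm \<xi>"
proof -
  obtain u where u: "u \<in> carrier_vec n" "l2_norm u \<le> 1" "\<xi> = of_real (l2_norm \<xi>) \<cdot>\<^sub>v u"
    using l2_norm_normalize[OF \<xi>] by blast
  have "column_value f C u \<le> column_norm S n C"
    unfolding column_norm_def
  proof (rule cSup_upper)
    show "bdd_above {column_value f C \<xi> |f \<xi>. f \<in> S \<and> \<xi> \<in> carrier_vec n \<and> l2_norm \<xi> \<le> 1}"
      unfolding bdd_above_def using column_value_le_sum[OF _ C] S(2) by blast
  qed (use u f in blast)
  moreover have "column_value f C \<xi> = l2_norm \<xi> * column_value f C u"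
    by (subst u(3)) (simp add: column_value_smult[OF C u(1)])
  ultimately show ?thesis by (simp add: mult.commute mult_left_mono)
qed

lemma column_norm_le:
  assumes "\<And>f \<xi>. f \<in> S \<Longrightarrow> \<xi> \<in> carrier_vec n \<Longrightarrow> l2_norm \<xi> \<le> 1 \<Longrightarrow> column_value f C \<xi> \<le> k"
  shows "column_norm S n C \<le> k"
  unfolding column_norm_def
proof (rule cSup_least)
  obtain \<phi> where "\<phi> \<in> dual_ball" by (rule norming_dual_ball)
  then have "column_value (\<phi>, 0) C (0\<^sub>v n) \<in> {column_value f C \<xi> |f \<xi>. f \<in> S \<and> \<xi> \<in> carrier_vec n \<and> l2_norm \<xi> \<le> 1}"
    using S by fastforce
  then show "{column_value f C \<xi> |f \<xi>. f \<in> S \<and> \<xi> \<in> carrier_vec n \<and> l2_norm \<xi> \<le> 1} \<noteq> {}" by blast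
qed (use assms in auto)

lemma column_norm_nonneg:
  assumes "C \<in> carrier_mat n n" "n \<ge> 1"
  shows "0 \<le> column_norm S n C"
proof -
  obtain \<phi> where "\<phi> \<in> dual_ball" by (rule norming_dual_ball)
  then have "column_value (\<phi>, 0) C (unit_vec n 0) \<le> column_norm S n C * l2_norm (unit_vec n 0)"
    using S assms by (intro column_value_le) auto
  then have "0 \<le> column_norm S n C * l2_norm (unit_vec n 0)"
    by (rule order_trans[OF column_value_nonneg])
  then show ?thesis using assms(2) by simp
qed

lemma column_value_le_column_norm:
  assumes "f \<in> S" "C \<in> carrier_mat n n" "\<xi> \<in> carrier_vec n" "l2_norm \<xi> \<le> 1" "n \<ge> 1"
  shows "column_value f C \<xi> \<le> column_norm S n C"
  using column_value_le[OF assms(1-3)] mult_left_le[OF assms(4) column_norm_nonneg[OF assms(2,5)]]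
  by linarith

text \<open>Each entry is detected by its own norming functional, applied to the unit vector of its
  column.\<close>

lemma column_norm_eq_0D:
  assumes C: "C \<in> carrier_mat n n" and 0: "column_norm S n C = 0"
  shows "C = 0\<^sub>m n n"
proof (rule eq_matI)
  fix i j assume "i < dim_row (0\<^sub>m n n :: (complex ^ 'n) Matrix.mat)" "j < dim_col (0\<^sub>m n n :: (complex ^ 'n) Matrix.mat)"
  then have ij: "i < n" "j < n" by auto
  obtain \<phi> where \<phi>: "\<phi> \<in> dual_ball" "bilin \<phi> (C $$ (i, j)) = of_real (N (C $$ (i, j)))"
    by (rule norming_dual_ball)
  have "column_value (\<phi>, 0) C (unit_vec n j) \<le> 0"
    using column_value_le[of "(\<phi>, 0)" C n "unit_vec n j"] \<phi> S C 0 by auto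
  then have "(column_value (\<phi>, 0) C (unit_vec n j))\<^sup>2 = 0"
    using column_value_nonneg order_antisym by (metis zero_power2)
  then have "(l2_norm (map_mat (bilin \<phi>) C *\<^sub>v unit_vec n j))\<^sup>2 + (l2_norm (map_mat (bilin 0) C *\<^sub>v unit_vec n j))\<^sup>2 = 0"
    unfolding column_value_def fst_conv snd_conv by (subst (asm) real_sqrt_pow2) auto
  then have "l2_norm (map_mat (bilin \<phi>) C *\<^sub>v unit_vec n j) = 0"
    by (simp add: sum_power2_eq_zero_iff)
  then have "vec_index (map_mat (bilin \<phi>) C *\<^sub>v unit_vec n j) i = 0"
    using C ij by (intro l2_norm_eq_0D) auto
  then have "bilin \<phi> (C $$ (i, j)) = 0"
    using C ij by (simp add: scalar_prod_right_unit)
  then show "C $$ (i, j) = 0\<^sub>m n n $$ (i, j)" using \<phi> ij by (simp add: zero_iff)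
qed (use C in auto)

lemma column_norm_zero: "n \<ge> 1 \<Longrightarrow> column_norm S n (0\<^sub>m n n) = 0"
proof (rule antisym)
  show "column_norm S n (0\<^sub>m n n) \<le> 0"
  proof (rule column_norm_le)
    fix f :: "(complex ^ 'n) \<times> (complex ^ 'n)" and \<xi> :: "complex Matrix.vec" assume "\<xi> \<in> carrier_vec n"
    moreover have "map_mat (bilin \<phi>) (0\<^sub>m n n) = 0\<^sub>m n n" for \<phi> :: "complex ^ 'n"
      by (intro eq_matI) auto
    moreover have "(0\<^sub>m n n :: complex Matrix.mat) *\<^sub>v \<xi> = 0\<^sub>v n" if "\<xi> \<in> carrier_vec n"
      using that by (intro eq_vecI) auto
    ultimately show "column_value f (0\<^sub>m n n) \<xi> \<le> 0" by (simp add: column_value_def)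
  qed
qed (rule column_norm_nonneg, auto)

lemma column_norm_scale_le:
  assumes "C \<in> carrier_mat n n" "n \<ge> 1"
  shows "column_norm S n (map_mat ((*s) c) C) \<le> cmod c * column_norm S n C"
  using assms
  by (intro column_norm_le) (auto simp: column_value_scale intro!: mult_left_mono column_value_le_column_norm)

lemma column_norm_scale:
  assumes "C \<in> carrier_mat n n" "n \<ge> 1"
  shows "column_norm S n (map_mat ((*s) c) C) = cmod c * column_norm S n C"
proof (cases "c = 0")
  case True
  then have "map_mat ((*s) c) C = 0\<^sub>m n n" using assms by (intro eq_matI) auto
  then show ?thesis using True assms column_norm_zero by simp
next
  case False
  have "C = map_mat ((*s) (1 / c)) (map_mat ((*s) c) C)" using False by (intro eq_matI) auto
  then have "column_norm S n C \<le> cmod (1 / c) * column_norm S n (map_mat ((*s) c) C)"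
    using column_norm_scale_le[of "map_mat ((*s) c) C" n "1 / c"] assms by simp
  then have "cmod c * column_norm S n C \<le> column_norm S n (map_mat ((*s) c) C)"
    using False by (simp add: norm_divide field_simps)
  then show ?thesis using column_norm_scale_le[OF assms] by (intro antisym)
qed

lemma column_norm_triangle:
  assumes "C \<in> carrier_mat n n" "D \<in> carrier_mat n n" "n \<ge> 1"
  shows "column_norm S n (C + D) \<le> column_norm S n C + column_norm S n D"
proof (rule column_norm_le)
  fix f \<xi> assume "f \<in> S" "\<xi> \<in> carrier_vec n" "l2_norm \<xi> \<le> 1"
  then show "column_value f (C + D) \<xi> \<le> column_norm S n C + column_norm S n D"
    using column_value_add[OF assms(1,2), of \<xi> f] column_value_le_column_norm[of f C n \<xi>]
      column_value_le_column_norm[of f D n \<xi>] assms by linarith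
qed

text \<open>Upper bound: split the vector and use Pythagoras. Lower bound: pad a vector of either
  block with zeros.\<close>

lemma column_norm_dsum:
  assumes A: "A \<in> carrier_mat n n" and B: "B \<in> carrier_mat m m" and n: "n \<ge> 1" and m: "m \<ge> 1"
  shows "column_norm S (n + m) (mat_dsum A B) = max (column_norm S n A) (column_norm S m B)"
proof (rule antisym)
  have AB: "mat_dsum A B \<in> carrier_mat (n + m) (n + m)"
    using A B by (simp add: mat_dsum_def)
  define M where "M = max (column_norm S n A) (column_norm S m B)"
  have M: "M \<ge> 0" using column_norm_nonneg[OF A n] by (simp add: M_def)
  show "column_norm S (n + m) (mat_dsum A B) \<le> max (column_norm S n A) (column_norm S m B)"
    unfolding M_def[symmetric]
  proof (rule column_norm_le)
    fix f \<xi> assume f: "f \<in> S" and \<xi>: "\<xi> \<in> carrier_vec (n + m)" "l2_norm \<xi> \<le> 1"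
    define a b where "a = vec_first \<xi> n" and "b = vec_last \<xi> m"
    have ab: "a \<in> carrier_vec n" "b \<in> carrier_vec m" "\<xi> = a @\<^sub>v b"
      using \<xi> by (auto simp: a_def b_def)
    have "column_value f A a \<le> M * l2_norm a"
      using column_value_le[OF f A ab(1)] by (rule order_trans) (simp add: M_def mult_right_mono)
    moreover have "column_value f B b \<le> M * l2_norm b"
      using column_value_le[OF f B ab(2)] by (rule order_trans) (simp add: M_def mult_right_mono)
    ultimately have "(column_value f A a)\<^sup>2 + (column_value f B b)\<^sup>2 \<le> (M * l2_norm a)\<^sup>2 + (M * l2_norm b)\<^sup>2"
      by (intro add_mono power_mono) auto
    then have "(column_value f (mat_dsum A B) \<xi>)\<^sup>2 \<le> M\<^sup>2 * (l2_norm \<xi>)\<^sup>2"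
      unfolding ab(3) column_value_dsum[OF A B ab(1,2)] l2_norm_append
      by (simp add: power_mult_distrib distrib_left)
    also have "\<dots> \<le> M\<^sup>2" using \<xi>(2) by (intro mult_left_le) (auto simp: power_le_one)
    finally show "column_value f (mat_dsum A B) \<xi> \<le> M" using M by (rule power2_le_imp_le)
  qed
  have "column_norm S n A \<le> column_norm S (n + m) (mat_dsum A B)"
  proof (rule column_norm_le)
    fix f \<xi> assume f: "f \<in> S" and \<xi>: "\<xi> \<in> carrier_vec n" "l2_norm \<xi> \<le> 1"
    have "l2_norm (\<xi> @\<^sub>v 0\<^sub>v m) \<le> 1"
      using l2_norm_append[of \<xi> "0\<^sub>v m"] \<xi>(2) by simp
    then have "column_value f (mat_dsum A B) (\<xi> @\<^sub>v 0\<^sub>v m) \<le> column_norm S (n + m) (mat_dsum A B)"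
      using f \<xi> n AB by (intro column_value_le_column_norm) auto
    moreover have "column_value f A \<xi> \<le> column_value f (mat_dsum A B) (\<xi> @\<^sub>v 0\<^sub>v m)"
    proof (rule power2_le_imp_le)
      show "(column_value f A \<xi>)\<^sup>2 \<le> (column_value f (mat_dsum A B) (\<xi> @\<^sub>v 0\<^sub>v m))\<^sup>2"
        using column_value_dsum[OF A B \<xi>(1), of "0\<^sub>v m"] by simp
    qed simp
    ultimately show "column_value f A \<xi> \<le> column_norm S (n + m) (mat_dsum A B)"
      by linarith
  qed
  moreover have "column_norm S m B \<le> column_norm S (n + m) (mat_dsum A B)"
  proof (rule column_norm_le)
    fix f \<xi> assume f: "f \<in> S" and \<xi>: "\<xi> \<in> carrier_vec m" "l2_norm \<xi> \<le> 1"
    have "l2_norm (0\<^sub>v n @\<^sub>v \<xi>) \<le> 1"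
      using l2_norm_append[of "0\<^sub>v n" \<xi>] \<xi>(2) by simp
    then have "column_value f (mat_dsum A B) (0\<^sub>v n @\<^sub>v \<xi>) \<le> column_norm S (n + m) (mat_dsum A B)"
      using f \<xi> n AB by (intro column_value_le_column_norm) auto
    moreover have "column_value f B \<xi> \<le> column_value f (mat_dsum A B) (0\<^sub>v n @\<^sub>v \<xi>)"
    proof (rule power2_le_imp_le)
      show "(column_value f B \<xi>)\<^sup>2 \<le> (column_value f (mat_dsum A B) (0\<^sub>v n @\<^sub>v \<xi>))\<^sup>2"
        using column_value_dsum[OF A B _ \<xi>(1), of "0\<^sub>v n"] by simp
    qed simp
    ultimately show "column_value f B \<xi> \<le> column_norm S (n + m) (mat_dsum A B)"
      by linarith
  qed
  ultimately show "max (column_norm S n A) (column_norm S m B) \<le> column_norm S (n + m) (mat_dsum A B)"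
    by simp
qed

lemma column_norm_bimod_mult:
  assumes A: "A \<in> carrier_mat n m" and C: "C \<in> carrier_mat m m" and B: "B \<in> carrier_mat m n"
    and "n \<ge> 1" "m \<ge> 1"
  shows "column_norm S n (bimod_mult A C B) \<le> l2_op_norm A * column_norm S m C * l2_op_norm B"
proof (rule column_norm_le)
  fix f \<xi> assume f: "f \<in> S" and \<xi>: "\<xi> \<in> carrier_vec n" "l2_norm \<xi> \<le> 1"
  note pos = l2_op_norm_nonneg[OF A \<open>m \<ge> 1\<close>] l2_op_norm_nonneg[OF B \<open>n \<ge> 1\<close>] column_norm_nonneg[OF C \<open>m \<ge> 1\<close>]
  have B\<xi>: "l2_norm (B *\<^sub>v \<xi>) \<le> l2_op_norm B"
    using l2_norm_mult_mat_vec_le[OF B \<xi>(1)] mult_left_le[OF \<xi>(2) pos(2)] by linarith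
  have "column_value f (bimod_mult A C B) \<xi> \<le> l2_op_norm A * column_value f C (B *\<^sub>v \<xi>)"
    by (rule column_value_bimod_mult[OF A C B \<xi>(1) \<open>m \<ge> 1\<close>])
  also have "\<dots> \<le> l2_op_norm A * (column_norm S m C * l2_norm (B *\<^sub>v \<xi>))"
    using pos B \<xi> f C by (intro mult_left_mono column_value_le) auto
  also have "\<dots> \<le> l2_op_norm A * (column_norm S m C * l2_op_norm B)"
    using pos B\<xi> by (intro mult_left_mono) auto
  finally show "column_value f (bimod_mult A C B) \<xi> \<le> l2_op_norm A * column_norm S m C * l2_op_norm B"
    by (simp add: mult.assoc)
qed

text \<open>Contractivity of the members of \<open>S\<close> gives the upper bound; a norming
  functional, present in \<open>S\<close> with second component 0, attains it.\<close>

lemma column_norm_1: "column_norm S 1 (Matrix.mat 1 1 (\<lambda>_. x)) = N x"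
proof -
  have l2: "l2_norm (map_mat (bilin \<phi>) (Matrix.mat 1 1 (\<lambda>_. x)) *\<^sub>v \<xi>) = cmod (bilin \<phi> x) * l2_norm \<xi>"
    if "\<xi> \<in> carrier_vec 1" for \<phi> \<xi>
    using that by (simp add: l2_norm_def L2_set_def scalar_prod_def norm_mult)
  have val: "column_value f (Matrix.mat 1 1 (\<lambda>_. x)) \<xi> =
      sqrt ((cmod (bilin (fst f) x))\<^sup>2 + (cmod (bilin (snd f) x))\<^sup>2) * l2_norm \<xi>"
    if "\<xi> \<in> carrier_vec 1" for f \<xi>
    by (simp only: column_value_def l2[OF that] power_mult_distrib distrib_right[symmetric] real_sqrt_mult)
       (simp add: real_sqrt_mult)
  show ?thesis
  proof (rule antisym)
    show "column_norm S 1 (Matrix.mat 1 1 (\<lambda>_. x)) \<le> N x"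
    proof (rule column_norm_le)
      fix f \<xi> assume f: "f \<in> S" and \<xi>: "\<xi> \<in> carrier_vec 1" "l2_norm \<xi> \<le> 1"
      have "(cmod (bilin (fst f) x))\<^sup>2 + (cmod (bilin (snd f) x))\<^sup>2 \<le> (N x)\<^sup>2"
        using f S by (auto simp: column_contractions_def)
      then have "sqrt ((cmod (bilin (fst f) x))\<^sup>2 + (cmod (bilin (snd f) x))\<^sup>2) \<le> N x"
        using nonneg by (intro real_le_lsqrt) auto
      then have "sqrt ((cmod (bilin (fst f) x))\<^sup>2 + (cmod (bilin (snd f) x))\<^sup>2) * l2_norm \<xi> \<le> N x * 1"
        using \<xi> nonneg by (intro mult_mono) auto
      then show "column_value f (Matrix.mat 1 1 (\<lambda>_. x)) \<xi> \<le> N x" using val[OF \<xi>(1)] by simp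
    qed
    obtain \<phi> where \<phi>: "\<phi> \<in> dual_ball" "bilin \<phi> x = of_real (N x)" by (rule norming_dual_ball)
    have "column_value (\<phi>, 0) (Matrix.mat 1 1 (\<lambda>_. x)) (unit_vec 1 0) \<le> column_norm S 1 (Matrix.mat 1 1 (\<lambda>_. x))"
      using S \<phi> by (intro column_value_le_column_norm) auto
    then show "N x \<le> column_norm S 1 (Matrix.mat 1 1 (\<lambda>_. x))"
      using val[of "unit_vec 1 0" "(\<phi>, 0)"] \<phi> nonneg by simp
  qed
qed

lemma operator_space_structure_column_norm: "operator_space_structure N (column_norm S)"
  unfolding operator_space_structure_def is_norm_on_matrices_def
proof (intro conjI allI impI ballI iffI)
  fix n m :: nat and A B :: "(complex ^ 'n) Matrix.mat" assume "1 \<le> n" "1 \<le> m" "A \<in> carrier_mat n n" "B \<in> carrier_mat m m"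
  then show "column_norm S (m + n) (mat_dsum A B) = max (column_norm S n A) (column_norm S m B)"
    using column_norm_dsum[of A n B m] by (simp add: add.commute[of m n])
qed (simp_all add: column_norm_nonneg column_norm_eq_0D column_norm_zero column_norm_scale
  column_norm_triangle column_norm_bimod_mult column_norm_1[simplified])

end

text \<open>The column with entries \<open>b1\<close>, \<open>b2\<close> has \<open>MIN\<close>-norm
  at most 1 by the second hypothesis. Adjoining the contraction \<open>(a1, a2)\<close> raises its
  norm above 1 by the third, while level one is unchanged.\<close>

lemma not_unique_operator_space_structure:
  assumes a: "\<And>z. (cmod (bilin a1 z))\<^sup>2 + (cmod (bilin a2 z))\<^sup>2 \<le> (N z)\<^sup>2"
    and b: "\<And>\<phi>. \<phi> \<in> dual_ball \<Longrightarrow> (cmod (bilin b1 \<phi>))\<^sup>2 + (cmod (bilin b2 \<phi>))\<^sup>2 \<le> 1"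
    and big: "(cmod (bilin a1 b1))\<^sup>2 + (cmod (bilin a1 b2))\<^sup>2 + (cmod (bilin a2 b1))\<^sup>2 + (cmod (bilin a2 b2))\<^sup>2 > 1"
  shows "\<not> unique_operator_space_structure N"
proof
  assume unique: "unique_operator_space_structure N"
  define S S' where "S = dual_ball \<times> {0 :: complex ^ 'n}" and "S' = insert (a1, a2) S"
  have sub: "dual_ball \<times> {0} \<subseteq> S" "S \<subseteq> column_contractions"
      "dual_ball \<times> {0} \<subseteq> S'" "S' \<subseteq> column_contractions"
    using dual_ball_column a by (auto simp: S_def S'_def column_contractions_def)
  \<comment> \<open>Only square matrices are measured, so the column is padded with a zero column;
    then only \<open>vec_index \<xi> 0\<close> matters.\<close>
  define C where "C = Matrix.mat 2 2 (\<lambda>(i, j). if j = 0 then (if i = 0 then b1 else b2) else 0)"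
  have C: "C \<in> carrier_mat 2 2" by (simp add: C_def)
  have l2: "(l2_norm (map_mat (bilin \<phi>) C *\<^sub>v \<xi>))\<^sup>2 =
      ((cmod (bilin \<phi> b1))\<^sup>2 + (cmod (bilin \<phi> b2))\<^sup>2) * (cmod (vec_index \<xi> 0))\<^sup>2"
    if "\<xi> \<in> carrier_vec 2" for \<phi> \<xi>
    using that
    by (simp add: C_def l2_norm_def L2_set_def scalar_prod_def numeral_2_eq_2 norm_mult
        power_mult_distrib distrib_right)
  have eq: "column_norm S 2 C = column_norm S' 2 C"
    using unique operator_space_structure_column_norm[OF sub(1,2)]
      operator_space_structure_column_norm[OF sub(3,4)] C
    unfolding unique_operator_space_structure_def by (metis one_le_numeral)
  have "column_norm S 2 C \<le> 1"
  proof (rule column_norm_le[OF sub(1,2)])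
    fix f and \<xi> :: "complex Matrix.vec" assume f: "f \<in> S" and \<xi>: "\<xi> \<in> carrier_vec 2" "l2_norm \<xi> \<le> 1"
    then obtain \<phi> where \<phi>: "f = (\<phi>, 0)" "\<phi> \<in> dual_ball" by (auto simp: S_def)
    have "cmod (vec_index \<xi> 0) \<le> 1" using component_le_l2_norm[of 0 \<xi>] \<xi> by simp
    then have "((cmod (bilin \<phi> b1))\<^sup>2 + (cmod (bilin \<phi> b2))\<^sup>2) * (cmod (vec_index \<xi> 0))\<^sup>2 \<le> 1 * 1"
      using b[OF \<phi>(2)] by (intro mult_mono) (auto simp: bilin_commute power_le_one)
    then show "column_value f C \<xi> \<le> 1"
      by (simp add: column_value_def \<phi>(1) l2[OF \<xi>(1)])
  qed
  then have "column_value (a1, a2) C (unit_vec 2 0) \<le> 1"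
    using column_value_le_column_norm[OF sub(3,4) _ C, of "(a1, a2)" "unit_vec 2 0"]
    by (simp add: S'_def eq)
  then show False using big by (simp add: column_value_def l2)
qed

end

section \<open>Property P\<close>

text \<open>Cauchy-Schwarz in dimension two, from \<open>2 x y \<le> x^2 + y^2\<close> in each
  coordinate.\<close>

lemma cmod_sum_products_le_1:
  assumes "(cmod a)\<^sup>2 + (cmod b)\<^sup>2 \<le> 1" "(cmod c)\<^sup>2 + (cmod d)\<^sup>2 \<le> 1"
  shows "cmod (a * c + b * d) \<le> 1"
proof -
  have "cmod (a * c + b * d) \<le> cmod a * cmod c + cmod b * cmod d"
    by (metis norm_mult norm_triangle_ineq)
  then show ?thesis
    using assms zero_le_power2[of "cmod a - cmod c"] zero_le_power2[of "cmod b - cmod d"]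
    by (simp add: power2_diff)
qed

lemma cmod_bilin_le_sum:
  fixes l m :: "complex ^ 'n"
  assumes "\<And>i. cmod (l $ i) \<le> 1"
  shows "cmod (bilin l m) \<le> (\<Sum>i\<in>UNIV. cmod (m $ i))"
  unfolding bilin_def
  by (rule order_trans[OF norm_sum]) (use assms in \<open>auto simp: norm_mult intro!: sum_mono mult_left_le_one_le\<close>)

lemma matrix_vector_mult_bilin: "(A *v x) $ i = bilin (A $ i) x" for A :: "complex ^ 'n ^ 'm"
  by (simp add: matrix_vector_mult_def bilin_def)

lemma hs_inner_eq:
  fixes A B :: "complex ^ 'n ^ 'n"
  shows "hs_inner A B = (\<Sum>i\<in>UNIV. \<Sum>j\<in>UNIV. A $ i $ j * cnj (B $ i $ j))"
  by (simp add: hs_inner_def trace_def matrix_matrix_mult_def conj_transpose_def)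

text \<open>The matrix \<open>a a^T + b b^T\<close>, with transposes instead of adjoints to match
  the bilinear pairing; the two agree for real vectors.\<close>

definition gram :: "complex ^ 'n \<Rightarrow> complex ^ 'n \<Rightarrow> complex ^ 'n ^ 'n" where
  "gram a b = (\<chi> i j. a $ i * a $ j + b $ i * b $ j)"

lemma gram_mult_vec: "gram a b *v x = bilin a x *s a + bilin b x *s b"
  unfolding Finite_Cartesian_Product.vec_eq_iff matrix_vector_mult_bilin
  by (simp add: gram_def bilin_def distrib_left distrib_right sum.distrib sum_distrib_left sum_distrib_right mult_ac)

lemma bilin_gram: "bilin l (gram a b *v x) = bilin a l * bilin a x + bilin b l * bilin b x"
  by (simp add: gram_mult_vec bilin_add_right bilin_scale_right bilin_commute[of l] mult.commute)

lemma pos_semidef_gram: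
  fixes a b :: "complex ^ 'n"
  assumes "\<And>i. a $ i \<in> \<real>" "\<And>i. b $ i \<in> \<real>"
  shows "pos_semidef (gram a b)"
  unfolding pos_semidef_def
proof (intro conjI allI)
  have real: "cnj (a $ i) = a $ i" "cnj (b $ i) = b $ i" for i
    using assms by (auto simp: Reals_cnj_iff)
  show "conj_transpose (gram a b) = gram a b"
    by (simp add: conj_transpose_def gram_def Finite_Cartesian_Product.vec_eq_iff real mult.commute)
  fix x
  have "(\<Sum>i\<in>UNIV. cnj (x $ i) * (gram a b *v x) $ i) = bilin (\<chi> i. cnj (x $ i)) (gram a b *v x)"
    by (simp add: bilin_def)
  also have "\<dots> = cnj (bilin a x) * bilin a x + cnj (bilin b x) * bilin b x"
    by (simp add: bilin_gram) (simp add: bilin_def real)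
  also have "\<dots> = of_real ((cmod (bilin a x))\<^sup>2 + (cmod (bilin b x))\<^sup>2)"
    unfolding of_real_add complex_norm_square by (simp add: mult.commute)
  finally show "0 \<le> Re (\<Sum>i\<in>UNIV. cnj (x $ i) * (gram a b *v x) $ i)"
    by simp
qed

lemma hs_inner_gram:
  fixes a b c d :: "complex ^ 'n"
  assumes "\<And>i. c $ i \<in> \<real>" "\<And>i. d $ i \<in> \<real>"
  shows "hs_inner (gram a b) (gram c d) = (bilin a c)\<^sup>2 + (bilin a d)\<^sup>2 + (bilin b c)\<^sup>2 + (bilin b d)\<^sup>2"
proof -
  have real: "cnj (c $ i) = c $ i" "cnj (d $ i) = d $ i" for i
    using assms by (auto simp: Reals_cnj_iff)
  have sq: "(bilin a c)\<^sup>2 = (\<Sum>i\<in>UNIV. \<Sum>j\<in>UNIV. a $ i * a $ j * (c $ i * c $ j))" for a c :: "complex ^ 'n"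
    by (simp add: bilin_def power2_eq_square sum_product mult_ac)
  show ?thesis
    unfolding hs_inner_eq sq by (simp add: gram_def real algebra_simps sum.distrib)
qed

section \<open>Dual norm, operator norms and failure of Property P\<close>

context norm_on_Cn
begin

lemma dual_norm_eq: "dual_norm N \<mu> = Sup {cmod (bilin l \<mu>) |l. N l \<le> 1}"
  by (simp add: dual_norm_def bilin_def)

lemma cmod_bilin_le_sum_of_ball: "N l \<le> 1 \<Longrightarrow> cmod (bilin l \<mu>) \<le> (\<Sum>i\<in>UNIV. cmod (\<mu> $ i))"
  using component_le order_trans by (intro cmod_bilin_le_sum) blast

lemma cmod_bilin_le_dual_norm: "N l \<le> 1 \<Longrightarrow> cmod (bilin l \<mu>) \<le> dual_norm N \<mu>"
  unfolding dual_norm_eq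
  by (rule cSup_upper) (use cmod_bilin_le_sum_of_ball in \<open>auto simp: bdd_above_def\<close>)

lemma dual_norm_le:
  assumes "\<And>l. N l \<le> 1 \<Longrightarrow> cmod (bilin l \<mu>) \<le> k"
  shows "dual_norm N \<mu> \<le> k"
proof -
  have "N 0 \<le> 1" using zero_iff[of 0] by simp
  then show ?thesis unfolding dual_norm_eq by (intro cSup_least) (use assms in auto)
qed

lemma dual_norm_zero: "dual_norm N 0 = 0"
  using dual_norm_le[of 0 0] cmod_bilin_le_dual_norm[of 0 0] zero_iff[of 0] by simp

lemma dual_norm_le_1D:
  assumes "dual_norm N \<mu> \<le> 1"
  shows "\<mu> \<in> dual_ball"
proof -
  have "cmod (bilin \<mu> z) \<le> N z" for z
  proof (cases "z = 0")
    case True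
    then show ?thesis using nonneg by simp
  next
    case False
    then have pos: "N z > 0" using nonneg[of z] zero_iff[of z] by linarith
    define y where "y = of_real (1 / N z) *s z"
    have "N y = cmod (of_real (1 / N z)) * N z" unfolding y_def by (rule scale)
    then have "N y = 1" using pos by (simp only: norm_of_real) simp
    then have "cmod (bilin y \<mu>) \<le> 1"
      using cmod_bilin_le_dual_norm[of y \<mu>] assms by simp
    then have "cmod (of_real (1 / N z)) * cmod (bilin \<mu> z) \<le> 1"
      unfolding bilin_commute[of y] by (simp only: y_def bilin_scale_right norm_mult)
    then show ?thesis using pos by (simp only: norm_of_real) (simp add: field_simps)
  qed
  then show ?thesis by (simp add: dual_ball_def)
qed

text \<open>A norming functional has coordinates of modulus at most 1, because the axis vectors lie
  in the unit ball.\<close>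

lemma le_sum_cmod: "N y \<le> (\<Sum>i\<in>UNIV. cmod (y $ i))"
proof -
  obtain \<phi> where \<phi>: "\<phi> \<in> dual_ball" "bilin \<phi> y = of_real (N y)" by (rule norming_dual_ball)
  have "cmod (\<phi> $ i) \<le> 1" for i
    using \<phi>(1) axis_le[of i] unfolding dual_ball_def bilin_axis[symmetric, of \<phi> i]
    using order_trans by blast
  then have "cmod (bilin \<phi> y) \<le> (\<Sum>i\<in>UNIV. cmod (y $ i))" by (rule cmod_bilin_le_sum)
  then show ?thesis using \<phi>(2) nonneg by simp
qed

text \<open>An entry is a pairing with axis vectors of norm at most 1. The supremum in
  \<open>op_norm\<close> dominates its members only once it is known to be bounded, which the crude
  entry sum provides.\<close>

lemma entry_le_1_of_op_norm_dual:
  fixes A :: "complex ^ 'n ^ 'n"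
  assumes "op_norm N (dual_norm N) A \<le> 1"
  shows "cmod (A $ i $ j) \<le> 1"
proof -
  have "dual_norm N (A *v x) \<le> (\<Sum>i\<in>UNIV. \<Sum>j\<in>UNIV. cmod (A $ i $ j))" if "N x \<le> 1" for x
  proof (rule dual_norm_le)
    fix l assume "N l \<le> 1"
    then have "cmod (bilin l (A *v x)) \<le> (\<Sum>i\<in>UNIV. cmod (bilin (A $ i) x))"
      using cmod_bilin_le_sum_of_ball[of l "A *v x"] by (simp add: matrix_vector_mult_bilin)
    also have "\<dots> \<le> (\<Sum>i\<in>UNIV. \<Sum>j\<in>UNIV. cmod (A $ i $ j))"
      using that by (intro sum_mono) (simp add: bilin_commute[of _ x] cmod_bilin_le_sum_of_ball)
    finally show "cmod (bilin l (A *v x)) \<le> (\<Sum>i\<in>UNIV. \<Sum>j\<in>UNIV. cmod (A $ i $ j))" .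
  qed
  then have "dual_norm N (A *v axis j 1) \<le> op_norm N (dual_norm N) A"
    unfolding op_norm_def by (intro cSup_upper) (use axis_le in \<open>auto simp: bdd_above_def\<close>)
  moreover have "cmod (bilin (axis i 1) (A *v axis j 1)) \<le> dual_norm N (A *v axis j 1)"
    by (rule cmod_bilin_le_dual_norm[OF axis_le])
  ultimately show ?thesis
    using assms by (simp add: bilin_commute[of "axis i 1"] bilin_axis matrix_vector_mult_bilin)
qed

lemma entry_le_1_of_op_norm_predual:
  fixes B :: "complex ^ 'n ^ 'n"
  assumes "op_norm (dual_norm N) N B \<le> 1"
  shows "cmod (B $ i $ j) \<le> 1"
proof -
  have "N (B *v x) \<le> (\<Sum>i\<in>UNIV. \<Sum>j\<in>UNIV. cmod (B $ i $ j))" if "dual_norm N x \<le> 1" for x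
  proof -
    have x: "cmod (x $ k) \<le> 1" for k
      using cmod_bilin_le_dual_norm[OF axis_le, of k x] that
      by (simp add: bilin_commute[of "axis k 1"] bilin_axis)
    have "N (B *v x) \<le> (\<Sum>i\<in>UNIV. cmod (bilin (B $ i) x))"
      using le_sum_cmod[of "B *v x"] by (simp add: matrix_vector_mult_bilin)
    also have "\<dots> \<le> (\<Sum>i\<in>UNIV. \<Sum>j\<in>UNIV. cmod (B $ i $ j))"
      using x by (intro sum_mono) (simp add: bilin_commute[of _ x] cmod_bilin_le_sum)
    finally show ?thesis .
  qed
  moreover have "dual_norm N (axis j 1) \<le> 1"
    by (rule dual_norm_le) (auto simp: bilin_axis intro: order_trans[OF component_le])
  ultimately have "N (B *v axis j 1) \<le> op_norm (dual_norm N) N B"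
    unfolding op_norm_def by (intro cSup_upper) (auto simp: bdd_above_def)
  moreover have "cmod ((B *v axis j 1) $ i) \<le> N (B *v axis j 1)" by (rule component_le)
  ultimately show ?thesis
    using assms by (simp add: bilin_axis matrix_vector_mult_bilin)
qed

text \<open>Both Gram matrices factor through Euclidean space by contractions, so Cauchy-Schwarz
  bounds their operator norms by 1. Their inner product is the sum in the last hypothesis.\<close>

lemma not_property_P:
  fixes a1 a2 b1 b2 :: "complex ^ 'n"
  assumes a: "\<And>z. (cmod (bilin a1 z))\<^sup>2 + (cmod (bilin a2 z))\<^sup>2 \<le> (N z)\<^sup>2"
    and b: "\<And>\<phi>. \<phi> \<in> dual_ball \<Longrightarrow> (cmod (bilin b1 \<phi>))\<^sup>2 + (cmod (bilin b2 \<phi>))\<^sup>2 \<le> 1"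
    and real: "\<And>i. a1 $ i \<in> \<real>" "\<And>i. a2 $ i \<in> \<real>" "\<And>i. b1 $ i \<in> \<real>" "\<And>i. b2 $ i \<in> \<real>"
    and big: "(cmod (bilin a1 b1))\<^sup>2 + (cmod (bilin a1 b2))\<^sup>2 + (cmod (bilin a2 b1))\<^sup>2 + (cmod (bilin a2 b2))\<^sup>2 > 1"
  shows "\<not> property_P N"
proof -
  define A B where "A = gram a1 a2" and "B = gram b1 b2"
  define G where "G = {Re (hs_inner A B) |A B. pos_semidef A \<and> pos_semidef B \<and>
     op_norm N (dual_norm N) A \<le> 1 \<and> op_norm (dual_norm N) N B \<le> 1}"
  have ball: "(cmod (bilin a1 z))\<^sup>2 + (cmod (bilin a2 z))\<^sup>2 \<le> 1" if "N z \<le> 1" for z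
    using a[of z] power_le_one[OF nonneg that, of 2] by linarith
  have N0: "N 0 \<le> 1" using zero_iff[of 0] by simp
  have opA: "op_norm N (dual_norm N) A \<le> 1"
    unfolding op_norm_def
  proof (rule cSup_least)
    show "{dual_norm N (A *v x) |x. N x \<le> 1} \<noteq> {}" using N0 by blast
    fix y assume "y \<in> {dual_norm N (A *v x) |x. N x \<le> 1}"
    then obtain x where x: "y = dual_norm N (A *v x)" "N x \<le> 1" by blast
    show "y \<le> 1"
      unfolding x(1) A_def by (intro dual_norm_le) (simp add: bilin_gram cmod_sum_products_le_1 ball x(2))
  qed
  have opB: "op_norm (dual_norm N) N B \<le> 1"
    unfolding op_norm_def
  proof (rule cSup_least)
    have "dual_norm N 0 \<le> 1" by (simp add: dual_norm_zero)
    then show "{N (B *v x) |x. dual_norm N x \<le> 1} \<noteq> {}" by blast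
    fix y assume "y \<in> {N (B *v x) |x. dual_norm N x \<le> 1}"
    then obtain x where x: "y = N (B *v x)" "dual_norm N x \<le> 1" by blast
    obtain \<phi> where \<phi>: "\<phi> \<in> dual_ball" "bilin \<phi> (B *v x) = of_real (N (B *v x))" by (rule norming_dual_ball)
    have "cmod (bilin \<phi> (B *v x)) \<le> 1"
      unfolding B_def bilin_gram
      by (intro cmod_sum_products_le_1 b \<phi>(1) dual_norm_le_1D x(2))
    then show "y \<le> 1" using \<phi>(2) x(1) nonneg by simp
  qed
  have "Re (hs_inner A B) \<in> G"
    unfolding G_def using opA opB pos_semidef_gram[OF real(1,2)] pos_semidef_gram[OF real(3,4)]
    unfolding A_def B_def by blast
  \<comment> \<open>Needed for \<open>Sup\<close> to dominate the witness: admissible matrices have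
    entries of modulus at most 1.\<close>
  moreover have "bdd_above G"
  proof (rule bdd_aboveI)
    fix y assume "y \<in> G"
    then obtain A B where y: "y = Re (hs_inner A B)"
      and "op_norm N (dual_norm N) A \<le> 1" "op_norm (dual_norm N) N B \<le> 1"
      by (auto simp: G_def)
    then have e: "cmod (A $ i $ j) \<le> 1" "cmod (B $ i $ j) \<le> 1" for i j
      using entry_le_1_of_op_norm_dual entry_le_1_of_op_norm_predual by auto
    have "y \<le> cmod (hs_inner A B)" unfolding y by (rule complex_Re_le_cmod)
    also have "\<dots> \<le> (\<Sum>i\<in>(UNIV::'n set). \<Sum>j\<in>(UNIV::'n set). 1)"
      unfolding hs_inner_eq
      by (intro order_trans[OF norm_sum] sum_mono)
         (auto simp: norm_mult intro!: mult_le_one e)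
    finally show "y \<le> (\<Sum>i\<in>(UNIV::'n set). \<Sum>j\<in>(UNIV::'n set). 1)" .
  qed
  ultimately have "Re (hs_inner A B) \<le> gamma_const N"
    unfolding gamma_const_def G_def[symmetric] by (rule cSup_upper)
  moreover have "Re ((bilin l m)\<^sup>2) = (cmod (bilin l m))\<^sup>2"
    if "\<And>i. l $ i \<in> \<real>" "\<And>i. m $ i \<in> \<real>" for l m :: "complex ^ 'n"
  proof -
    have "bilin l m \<in> \<real>" unfolding bilin_def using that by (intro sum_in_Reals Reals_mult) auto
    then show ?thesis by (auto elim!: Reals_cases simp: of_real_power[symmetric] simp del: of_real_power)
  qed
  ultimately have "gamma_const N > 1"
    using big real by (simp add: A_def B_def hs_inner_gram)
  then show ?thesis by (simp add: property_P_def)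
qed

end

section \<open>The main theorem\<close>

text \<open>Isolates the phase defect, which is nonnegative. When two such squares are added, a
  nonnegative total off-diagonal coefficient lets an upper bound pass from moduli to complex
  vectors.\<close>

lemma cmod_sq_real_combination:
  "(cmod (of_real a * z + of_real b * w))\<^sup>2 =
    (a * cmod z + b * cmod w)\<^sup>2 - 2 * (a * b) * (cmod z * cmod w - Re (z * cnj w))"
proof -
  have "(cmod (of_real a * z + of_real b * w))\<^sup>2 =
      a\<^sup>2 * (cmod z)\<^sup>2 + b\<^sup>2 * (cmod w)\<^sup>2 + 2 * (a * b) * Re (z * cnj w)"
    unfolding cmod_power2 by (simp add: power2_eq_square algebra_simps)
  then show ?thesis by (simp add: power2_eq_square algebra_simps)
qed

lemma unit_phase: obtains u where "cmod u = 1" "u * z = of_real (cmod z)"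
proof (cases "z = 0")
  case True
  then show ?thesis using that[of 1] by simp
next
  case False
  show ?thesis
  proof (rule that[of "cnj (sgn z)"])
    show "cmod (cnj (sgn z)) = 1" using False by (simp add: norm_sgn)
    show "cnj (sgn z) * z = of_real (cmod z)"
      by (rule cnj_sgn_mult)
  qed
qed

theorem theorem1p4:
  fixes p q :: real
  assumes "1 \<le> p" and "1 \<le> q" and "p > 1 \<or> q > 1"
  shows "\<not> property_P (norm_Bpq p q) \<and> \<not> unique_operator_space_structure (norm_Bpq p q)"
proof -
  define N where "N = norm_Bpq p q"
  interpret norm_on_Cn N unfolding N_def by (rule norm_on_Cn_norm_Bpq[OF assms(1,2)])
  obtain v1 r0 v2 s0 t T where
    dual: "v1 * r0 + v2 * s0 = 1" and off: "t * (r0 * s0) \<le> v1 * v2" "v1 * v2 \<le> T * (r0 * s0)"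
    and pos: "r0 > 0" "s0 > 0" "v1 > 0" "v2 > 0" "t > 0" "T > 0"
    and lo: "\<And>r s. r \<ge> 0 \<Longrightarrow> s \<ge> 0 \<Longrightarrow> r powr p + s powr q = 1 \<Longrightarrow>
      (v1 * r + v2 * s)\<^sup>2 + t * (s0 * r - r0 * s)\<^sup>2 \<le> 1"
    and up: "\<And>r s. r \<ge> 0 \<Longrightarrow> s \<ge> 0 \<Longrightarrow> r powr p + s powr q = 1 \<Longrightarrow>
      1 \<le> (v1 * r + v2 * s)\<^sup>2 + T * (s0 * r - r0 * s)\<^sup>2"
    by (rule curve_between_ellipses[OF assms]) (rule that)
  define vec2 :: "real \<Rightarrow> real \<Rightarrow> complex ^ 2" where
    "vec2 x y = vector [of_real x, of_real y]" for x y
  have vec2 [simp]: "vec2 x y $ 1 = of_real x" "vec2 x y $ 2 = of_real y" for x y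
    by (simp_all add: vec2_def)
  have vec2_real: "vec2 x y $ i \<in> \<real>" for x y i
    using exhaust_2[of i] by auto
  have bilin_vec2: "bilin (vec2 x y) z = of_real x * z $ 1 + of_real y * z $ 2" for x y z
    by (simp add: bilin_2)
  \<comment> \<open>With \<open>w = (v2, -v1)\<close>, the pairs \<open>(v, u)\<close> and
    \<open>((r0, s0), w)\<close> are dual bases; the second vectors are scaled by
    \<open>sqrt t\<close> and \<open>1 / sqrt T\<close>.\<close>
  define a1 a2 b1 b2 where "a1 = vec2 v1 v2" and "a2 = vec2 (sqrt t * s0) (- (sqrt t * r0))"
    and "b1 = vec2 r0 s0" and "b2 = vec2 (v2 / sqrt T) (- (v1 / sqrt T))"
  have a: "(cmod (bilin a1 z))\<^sup>2 + (cmod (bilin a2 z))\<^sup>2 \<le> (N z)\<^sup>2" for z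
  proof -
    \<comment> \<open>The square root gives homogeneity of degree 1, as
      \<open>norm_Bpq_homogeneous_le\<close> requires.\<close>
    have "sqrt ((cmod (bilin a1 z))\<^sup>2 + (cmod (bilin a2 z))\<^sup>2) \<le> N z"
      unfolding N_def
    proof (rule norm_Bpq_homogeneous_le[OF assms(1,2)])
      fix z :: "complex ^ 2" assume z: "pq_sum p q z = 1"
      define r s where "r = cmod (z $ 1)" and "s = cmod (z $ 2)"
      define D where "D = r * s - Re (z $ 1 * cnj (z $ 2))"
      have D: "D \<ge> 0"
        using complex_Re_le_cmod[of "z $ 1 * cnj (z $ 2)"] by (simp add: D_def r_def s_def norm_mult)
      have "(cmod (bilin a1 z))\<^sup>2 + (cmod (bilin a2 z))\<^sup>2 =
          ((v1 * r + v2 * s)\<^sup>2 - 2 * (v1 * v2) * D) +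
          ((sqrt t * s0 * r + - (sqrt t * r0) * s)\<^sup>2 - 2 * (sqrt t * s0 * - (sqrt t * r0)) * D)"
        unfolding a1_def a2_def bilin_vec2 cmod_sq_real_combination r_def s_def D_def ..
      also have "(sqrt t * s0 * r + - (sqrt t * r0) * s)\<^sup>2 = (sqrt t * (s0 * r - r0 * s))\<^sup>2"
        by (simp add: algebra_simps)
      also have "\<dots> = t * (s0 * r - r0 * s)\<^sup>2"
        using pos by (simp add: power_mult_distrib)
      also have "sqrt t * s0 * - (sqrt t * r0) = - (sqrt t * sqrt t * (r0 * s0))"
        by (simp add: mult_ac)
      also have "sqrt t * sqrt t = t" using pos by simp
      finally have "(cmod (bilin a1 z))\<^sup>2 + (cmod (bilin a2 z))\<^sup>2 =
          (v1 * r + v2 * s)\<^sup>2 + t * (s0 * r - r0 * s)\<^sup>2 - 2 * (v1 * v2 - t * (r0 * s0)) * D"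
        by (simp add: algebra_simps)
      also have "\<dots> \<le> 1"
      proof -
        have "2 * (v1 * v2 - t * (r0 * s0)) * D \<ge> 0" using off(1) D by simp
        moreover have "(v1 * r + v2 * s)\<^sup>2 + t * (s0 * r - r0 * s)\<^sup>2 \<le> 1"
          using z by (intro lo) (auto simp: r_def s_def pq_sum_def)
        ultimately show ?thesis by linarith
      qed
      finally show "sqrt ((cmod (bilin a1 z))\<^sup>2 + (cmod (bilin a2 z))\<^sup>2) \<le> 1" by simp
    next
      fix r :: real and z :: "complex ^ 2" assume "r > 0"
      then show "sqrt ((cmod (bilin a1 (r *\<^sub>R z)))\<^sup>2 + (cmod (bilin a2 (r *\<^sub>R z)))\<^sup>2) =
          r * sqrt ((cmod (bilin a1 z))\<^sup>2 + (cmod (bilin a2 z))\<^sup>2)"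
        by (simp add: bilin_scaleR_right norm_mult power_mult_distrib real_sqrt_mult flip: distrib_left)
    qed simp
    then show ?thesis using sqrt_le_D by blast
  qed
  \<comment> \<open>The outer ellipse bound extends from the curve by scaling. It is kept in terms
    of moduli, since a phase defect could lower the form for complex vectors.\<close>
  have N_le: "(N z)\<^sup>2 \<le> (v1 * cmod (z $ 1) + v2 * cmod (z $ 2))\<^sup>2 + T * (s0 * cmod (z $ 1) - r0 * cmod (z $ 2))\<^sup>2" for z
  proof (cases "z = 0")
    case True
    then show ?thesis using zero_iff by simp
  next
    case False
    then obtain c y where c: "c > 0" and y: "pq_sum p q y = 1" "z = c *\<^sub>R y" "norm_Bpq p q z = c"
      by (rule norm_Bpq_polar[OF assms(1,2)])
    have "c\<^sup>2 * 1 \<le> c\<^sup>2 * ((v1 * cmod (y $ 1) + v2 * cmod (y $ 2))\<^sup>2 + T * (s0 * cmod (y $ 1) - r0 * cmod (y $ 2))\<^sup>2)"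
      using up[of "cmod (y $ 1)" "cmod (y $ 2)"] y(1) by (intro mult_left_mono) (auto simp: pq_sum_def)
    also have "\<dots> = (v1 * cmod (z $ 1) + v2 * cmod (z $ 2))\<^sup>2 + T * (s0 * cmod (z $ 1) - r0 * cmod (z $ 2))\<^sup>2"
      using c by (simp add: y(2) power2_eq_square algebra_simps)
    finally show ?thesis using y(3) by (simp add: N_def)
  qed
  have b: "(cmod (bilin b1 \<phi>))\<^sup>2 + (cmod (bilin b2 \<phi>))\<^sup>2 \<le> 1" if \<phi>: "\<phi> \<in> dual_ball" for \<phi>
  proof -
    define m1 m2 where "m1 = cmod (\<phi> $ 1)" and "m2 = cmod (\<phi> $ 2)"
    have m: "m1 \<ge> 0" "m2 \<ge> 0" by (simp_all add: m1_def m2_def)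
    define P W where "P = r0 * m1 + s0 * m2" and "W = v2 * m1 - v1 * m2"
    define Q where "Q = P\<^sup>2 + W\<^sup>2 / T"
    define D where "D = m1 * m2 - Re (\<phi> $ 1 * cnj (\<phi> $ 2))"
    have D: "D \<ge> 0"
      using complex_Re_le_cmod[of "\<phi> $ 1 * cnj (\<phi> $ 2)"] by (simp add: D_def m1_def m2_def norm_mult)
    have offT: "v1 * v2 / T \<le> r0 * s0" using off(2) pos by (simp add: pos_divide_le_eq mult.commute)
    have "(cmod (bilin b1 \<phi>))\<^sup>2 + (cmod (bilin b2 \<phi>))\<^sup>2 =
        (P\<^sup>2 - 2 * (r0 * s0) * D) +
        ((v2 / sqrt T * m1 + - (v1 / sqrt T) * m2)\<^sup>2 - 2 * (v2 / sqrt T * - (v1 / sqrt T)) * D)"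
      unfolding b1_def b2_def bilin_vec2 cmod_sq_real_combination m1_def m2_def D_def P_def ..
    also have "(v2 / sqrt T * m1 + - (v1 / sqrt T) * m2)\<^sup>2 = (W / sqrt T)\<^sup>2"
      by (simp add: W_def diff_divide_distrib)
    also have "\<dots> = W\<^sup>2 / T" using pos by (simp add: power_divide)
    also have "v2 / sqrt T * - (v1 / sqrt T) = - (v1 * v2 / T)"
      using pos by (simp add: mult.commute)
    finally have eq: "(cmod (bilin b1 \<phi>))\<^sup>2 + (cmod (bilin b2 \<phi>))\<^sup>2 = Q - 2 * (r0 * s0 - v1 * v2 / T) * D"
      by (simp add: Q_def algebra_simps)
    have "2 * (r0 * s0 - v1 * v2 / T) * D \<ge> 0" using offT D by simp
    then have le: "(cmod (bilin b1 \<phi>))\<^sup>2 + (cmod (bilin b2 \<phi>))\<^sup>2 \<le> Q"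
      using eq by linarith
    text \<open>\<open>(y\<^sub>1, y\<^sub>2)\<close> is the image of \<open>(m\<^sub>1, m\<^sub>2)\<close> under the matrix of the quadratic form \<open>Q\<close>; thus
      \<open>Q\<close> is its pairing with \<open>(m\<^sub>1, m\<^sub>2)\<close>, and also its value under the dual form, the one of the
      outer ellipse.\<close>
    define y1 y2 where "y1 = P * r0 + W / T * v2" and "y2 = P * s0 - W / T * v1"
    \<comment> \<open>The off-diagonal sign condition makes both coordinates nonnegative, so they
      can serve as moduli.\<close>
    have "y1 = r0 * r0 * m1 + v2 * v2 / T * m1 + (r0 * s0 - v1 * v2 / T) * m2"
      by (simp add: y1_def P_def W_def algebra_simps diff_divide_distrib)
    then have y1: "y1 \<ge> 0" using pos m offT by simp
    have "y2 = s0 * s0 * m2 + v1 * v1 / T * m2 + (r0 * s0 - v1 * v2 / T) * m1"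
      by (simp add: y2_def P_def W_def algebra_simps diff_divide_distrib)
    then have y2: "y2 \<ge> 0" using pos m offT by simp
    \<comment> \<open>These phases align the two terms of the pairing, so that
      \<open>bilin \<phi> z\<close> is exactly \<open>Q\<close>.\<close>
    obtain e1 e2 where e: "cmod e1 = 1" "e1 * \<phi> $ 1 = of_real m1" "cmod e2 = 1" "e2 * \<phi> $ 2 = of_real m2"
      using unit_phase unfolding m1_def m2_def by metis
    define z :: "complex ^ 2" where "z = vector [of_real y1 * e1, of_real y2 * e2]"
    have z: "cmod (z $ 1) = y1" "cmod (z $ 2) = y2"
      using e y1 y2 by (simp_all add: z_def norm_mult)
    have "bilin \<phi> z = of_real y1 * (e1 * \<phi> $ 1) + of_real y2 * (e2 * \<phi> $ 2)"
      by (simp add: bilin_2 z_def mult_ac)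
    also have "\<dots> = of_real (y1 * m1 + y2 * m2)" unfolding e by simp
    also have "y1 * m1 + y2 * m2 = Q"
      by (simp add: y1_def y2_def Q_def P_def W_def power2_eq_square algebra_simps diff_divide_distrib add_divide_distrib)
    finally have "bilin \<phi> z = of_real Q" .
    moreover have "Q \<ge> 0" using pos by (simp add: Q_def)
    moreover have "cmod (bilin \<phi> z) \<le> N z" using \<phi> by (simp add: dual_ball_def)
    ultimately have "Q \<le> N z" by simp
    then have "Q\<^sup>2 \<le> (N z)\<^sup>2" using \<open>Q \<ge> 0\<close> by (intro power_mono) auto
    also have "\<dots> \<le> (v1 * y1 + v2 * y2)\<^sup>2 + T * (s0 * y1 - r0 * y2)\<^sup>2"
      using N_le[of z] z by simp
    also have "v1 * y1 + v2 * y2 = P * (v1 * r0 + v2 * s0)"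
      by (simp add: y1_def y2_def algebra_simps)
    also have "s0 * y1 - r0 * y2 = W / T * (v1 * r0 + v2 * s0)"
      by (simp add: y1_def y2_def algebra_simps)
    finally have "Q\<^sup>2 \<le> P\<^sup>2 + T * (W / T)\<^sup>2" using dual by simp
    also have "\<dots> = Q" using pos by (simp add: Q_def power2_eq_square)
    finally have "Q \<le> 1" using \<open>Q \<ge> 0\<close>
      by (cases "Q = 0") (auto simp: power2_eq_square)
    then show ?thesis using le by linarith
  qed
  have prods: "bilin a1 b1 = 1" "bilin a2 b2 = of_real (sqrt t / sqrt T)"
  proof -
    have "bilin a1 b1 = of_real (v1 * r0 + v2 * s0)"
      by (simp add: a1_def b1_def bilin_vec2)
    then show "bilin a1 b1 = 1" using dual by simp
    have "bilin a2 b2 = of_real (sqrt t / sqrt T * (v1 * r0 + v2 * s0))"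
      by (simp add: a2_def b2_def bilin_vec2 algebra_simps add_divide_distrib)
    then show "bilin a2 b2 = of_real (sqrt t / sqrt T)" using dual by simp
  qed
  \<comment> \<open>The square of this entry is \<open>t / T\<close>, the excess over 1.\<close>
  have "cmod (bilin a2 b2) > 0" unfolding prods using pos by (simp del: of_real_divide)
  then have big: "(cmod (bilin a1 b1))\<^sup>2 + (cmod (bilin a1 b2))\<^sup>2 + (cmod (bilin a2 b1))\<^sup>2 + (cmod (bilin a2 b2))\<^sup>2 > 1"
    using prods(1) by (simp add: add_nonneg_pos)
  have "\<not> property_P N"
    by (rule not_property_P[OF a b _ _ _ _ big]) (auto simp: a1_def a2_def b1_def b2_def vec2_real)
  moreover have "\<not> unique_operator_space_structure N"
    by (rule not_unique_operator_space_structure[OF a b big])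
  ultimately show ?thesis by (simp add: N_def)
qed

end
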